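(* Let $\mathbf{I}$ be a small confluent category and $\Gamma \colon \mathbf{I} \to \mathbf{Taut}$ a functor. Then there is an isomorphism $$\varinjlim_I \Delta[\Gamma I] \cong \Delta\bigl[\varinjlim_I \Gamma(I)\bigr].$$
   Context: A functor is taut if it preserves inverse image diagrams, i.e. pullback squares in which one leg is a monomorphism (pullbacks of a monomorphism along an arbitrary morphism). A natural transformation is taut if its naturality squares at monomorphisms are pullbacks. $\mathbf{Taut}$ is the category of taut functors $\mathbf{Set}\to\mathbf{Set}$ and taut natural transformations. A category $\mathbf{I}$ is confluent if for every pair of arrows $\alpha_i \colon I \to I_i$ ($i=1,2$) with the same domain there exist $\beta_i \colon I_i \to J$ with $\beta_1\alpha_1=\beta_2\alpha_2$. Colimits are computed pointwise (in the category of all functors $\mathbf{Set}\to\mathbf{Set}$); a confluent colimit of taut functors is taut. For a taut functor $F \colon \mathbf{Set} \to \mathbf{Set}$ let $j_X \colon X \to X+1$ be the coproduct injection. The difference functor of $F$ is $\Delta[F](X) = F(X+1) \setminus \mathrm{Im}\, F(j_X)$; for $f \colon X \to Y$, $\Delta[F](f)$ is the restriction of $F(f+1)$ (which does restrict, because $F$ is taut). For a taut transformation $t \colon F \to G$, $\Delta[t](X)$ is the restriction of $t(X+1)$. This makes $\Delta$ a functor $\mathbf{Taut}\to\mathbf{Taut}$, and $I \mapsto \Delta[\Gamma I]$ is the composite diagram. *)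

theory Defs
  imports "HOL-Library.FuncSet"
begin

section \<open>Categories, functors, natural transformations\<close>

record ('o, 'a) cat =
  Obj :: "'o set"
  Arr :: "'a set"
  Dom :: "'a \<Rightarrow> 'o"
  Cod :: "'a \<Rightarrow> 'o"
  Id :: "'o \<Rightarrow> 'a"
  Comp :: "'a \<Rightarrow> 'a \<Rightarrow> 'a"

definition Hom :: "('o, 'a) cat \<Rightarrow> 'o \<Rightarrow> 'o \<Rightarrow> 'a set" where
  "Hom C X Y = {f \<in> Arr C. Dom C f = X \<and> Cod C f = Y}"

text \<open>\<open>Comp C g f\<close> is the composite of \<open>f\<close> followed by \<open>g\<close>.\<close>

locale category =
  fixes C :: "('o, 'a) cat"
  assumes dom_obj: "f \<in> Arr C \<Longrightarrow> Dom C f \<in> Obj C"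
    and cod_obj: "f \<in> Arr C \<Longrightarrow> Cod C f \<in> Obj C"
    and id_hom: "X \<in> Obj C \<Longrightarrow> Id C X \<in> Hom C X X"
    and comp_hom: "f \<in> Hom C X Y \<Longrightarrow> g \<in> Hom C Y Z \<Longrightarrow> Comp C g f \<in> Hom C X Z"
    and comp_id_right: "f \<in> Hom C X Y \<Longrightarrow> Comp C f (Id C X) = f"
    and comp_id_left: "f \<in> Hom C X Y \<Longrightarrow> Comp C (Id C Y) f = f"
    and comp_assoc: "f \<in> Hom C W X \<Longrightarrow> g \<in> Hom C X Y \<Longrightarrow> h \<in> Hom C Y Z \<Longrightarrow>
      Comp C h (Comp C g f) = Comp C (Comp C h g) f"

definition is_mono :: "('o, 'a) cat \<Rightarrow> 'a \<Rightarrow> bool" where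
  "is_mono C m \<longleftrightarrow> m \<in> Arr C \<and>
    (\<forall>W. \<forall>u\<in>Hom C W (Dom C m). \<forall>v\<in>Hom C W (Dom C m). Comp C m u = Comp C m v \<longrightarrow> u = v)"

text \<open>\<open>is_pullback C p q f g\<close>: the square \<open>f \<circ> p = g \<circ> q\<close> commutes and is a pullback of the
  cospan \<open>(f, g)\<close>.\<close>

definition is_pullback :: "('o, 'a) cat \<Rightarrow> 'a \<Rightarrow> 'a \<Rightarrow> 'a \<Rightarrow> 'a \<Rightarrow> bool" where
  "is_pullback C p q f g \<longleftrightarrow>
    {p, q, f, g} \<subseteq> Arr C \<and>
    Dom C p = Dom C q \<and> Cod C p = Dom C f \<and> Cod C q = Dom C g \<and> Cod C f = Cod C g \<and>
    Comp C f p = Comp C g q \<and>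
    (\<forall>W. \<forall>a\<in>Hom C W (Dom C f). \<forall>b\<in>Hom C W (Dom C g). Comp C f a = Comp C g b \<longrightarrow>
      (\<exists>!u. u \<in> Hom C W (Dom C p) \<and> Comp C p u = a \<and> Comp C q u = b))"

definition isomorphic :: "('o, 'a) cat \<Rightarrow> 'o \<Rightarrow> 'o \<Rightarrow> bool" where
  "isomorphic C X Y \<longleftrightarrow> X \<in> Obj C \<and> Y \<in> Obj C \<and>
    (\<exists>f\<in>Hom C X Y. \<exists>g\<in>Hom C Y X. Comp C g f = Id C X \<and> Comp C f g = Id C Y)"

definition confluent :: "('o, 'a) cat \<Rightarrow> bool" where
  "confluent C \<longleftrightarrow>
    (\<forall>f1\<in>Arr C. \<forall>f2\<in>Arr C. Dom C f1 = Dom C f2 \<longrightarrow>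
      (\<exists>J. \<exists>g1\<in>Hom C (Cod C f1) J. \<exists>g2\<in>Hom C (Cod C f2) J. Comp C g1 f1 = Comp C g2 f2))"

record ('o1, 'a1, 'o2, 'a2) func =
  OMap :: "'o1 \<Rightarrow> 'o2"
  AMap :: "'a1 \<Rightarrow> 'a2"

text \<open>Object and arrow maps are required to be \<^const>\<open>extensional\<close>, so that equality of
  functors is equality of records; likewise for natural transformations.\<close>

definition is_functor ::
  "('o1, 'a1) cat \<Rightarrow> ('o2, 'a2) cat \<Rightarrow> ('o1, 'a1, 'o2, 'a2) func \<Rightarrow> bool" where
  "is_functor C D F \<longleftrightarrow>
    OMap F \<in> Obj C \<rightarrow>\<^sub>E Obj D \<and>
    AMap F \<in> Arr C \<rightarrow>\<^sub>E Arr D \<and>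
    (\<forall>X Y. \<forall>f\<in>Hom C X Y. AMap F f \<in> Hom D (OMap F X) (OMap F Y)) \<and>
    (\<forall>X\<in>Obj C. AMap F (Id C X) = Id D (OMap F X)) \<and>
    (\<forall>X Y Z. \<forall>f\<in>Hom C X Y. \<forall>g\<in>Hom C Y Z.
      AMap F (Comp C g f) = Comp D (AMap F g) (AMap F f))"

text \<open>Composite of \<open>F\<close>, defined on \<open>C\<close>, followed by \<open>G\<close>.\<close>

definition comp_functor ::
  "('o1, 'a1) cat \<Rightarrow> ('o2, 'a2, 'o3, 'a3) func \<Rightarrow> ('o1, 'a1, 'o2, 'a2) func \<Rightarrow>
    ('o1, 'a1, 'o3, 'a3) func" where
  "comp_functor C G F =
    \<lparr>OMap = \<lambda>X\<in>Obj C. OMap G (OMap F X), AMap = \<lambda>f\<in>Arr C. AMap G (AMap F f)\<rparr>"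

record ('o1, 'a1, 'o2, 'a2) nat_trans =
  NDom :: "('o1, 'a1, 'o2, 'a2) func"
  NCod :: "('o1, 'a1, 'o2, 'a2) func"
  NMap :: "'o1 \<Rightarrow> 'a2"

definition is_nat_trans ::
  "('o1, 'a1) cat \<Rightarrow> ('o2, 'a2) cat \<Rightarrow> ('o1, 'a1, 'o2, 'a2) nat_trans \<Rightarrow> bool" where
  "is_nat_trans C D t \<longleftrightarrow>
    is_functor C D (NDom t) \<and> is_functor C D (NCod t) \<and>
    NMap t \<in> extensional (Obj C) \<and>
    (\<forall>X\<in>Obj C. NMap t X \<in> Hom D (OMap (NDom t) X) (OMap (NCod t) X)) \<and>
    (\<forall>X Y. \<forall>f\<in>Hom C X Y.
      Comp D (NMap t Y) (AMap (NDom t) f) = Comp D (AMap (NCod t) f) (NMap t X))"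

definition functor_cat ::
  "('o1, 'a1) cat \<Rightarrow> ('o2, 'a2) cat \<Rightarrow>
    (('o1, 'a1, 'o2, 'a2) func, ('o1, 'a1, 'o2, 'a2) nat_trans) cat" where
  "functor_cat C D =
    \<lparr>Obj = {F. is_functor C D F},
     Arr = {t. is_nat_trans C D t},
     Dom = NDom,
     Cod = NCod,
     Id = \<lambda>F. \<lparr>NDom = F, NCod = F, NMap = \<lambda>X\<in>Obj C. Id D (OMap F X)\<rparr>,
     Comp = \<lambda>s t. \<lparr>NDom = NDom t, NCod = NCod s,
       NMap = \<lambda>X\<in>Obj C. Comp D (NMap s X) (NMap t X)\<rparr>\<rparr>"

definition is_cocone ::
  "('i, 'b) cat \<Rightarrow> ('o, 'a) cat \<Rightarrow> ('i, 'b, 'o, 'a) func \<Rightarrow> 'o \<Rightarrow> ('i \<Rightarrow> 'a) \<Rightarrow> bool" where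
  "is_cocone I C D L l \<longleftrightarrow> L \<in> Obj C \<and>
    (\<forall>i\<in>Obj I. l i \<in> Hom C (OMap D i) L) \<and>
    (\<forall>i j. \<forall>f\<in>Hom I i j. Comp C (l j) (AMap D f) = l i)"

definition is_colimit ::
  "('i, 'b) cat \<Rightarrow> ('o, 'a) cat \<Rightarrow> ('i, 'b, 'o, 'a) func \<Rightarrow> 'o \<Rightarrow> ('i \<Rightarrow> 'a) \<Rightarrow> bool" where
  "is_colimit I C D L l \<longleftrightarrow> is_cocone I C D L l \<and>
    (\<forall>K k. is_cocone I C D K k \<longrightarrow>
      (\<exists>!h. h \<in> Hom C L K \<and> (\<forall>i\<in>Obj I. Comp C h (l i) = k i)))"


section \<open>The category of sets\<close>

text \<open>HOL has no type of all sets, so the category of sets is taken relative to an arbitrary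
  universe \<open>U\<close> of small subsets of a type \<open>'u\<close>. Every Grothendieck universe with an infinite
  member is of this form. Closure under power sets is not required, which only makes the notion
  more general.\<close>

locale set_universe =
  fixes U :: "'u set set"
  assumes infinite_member: "\<exists>N\<in>U. infinite N"
    and subset_closed: "X \<in> U \<Longrightarrow> Y \<subseteq> X \<Longrightarrow> Y \<in> U"
    and image_closed: "\<And>f :: 'u \<Rightarrow> 'u. X \<in> U \<Longrightarrow> f ` X \<in> U"
    and Union_closed: "\<And>A :: 'u \<Rightarrow> 'u set.
      X \<in> U \<Longrightarrow> (\<And>x. x \<in> X \<Longrightarrow> A x \<in> U) \<Longrightarrow> (\<Union>x\<in>X. A x) \<in> U"

lemma set_universe_UNIV:
  assumes "infinite (UNIV :: 'u set)"
  shows "set_universe (UNIV :: 'u set set)"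
  using assms by unfold_locales auto

definition small_set :: "'u set set \<Rightarrow> 'b set \<Rightarrow> bool" where
  "small_set U S \<longleftrightarrow> (\<exists>f. inj_on f S \<and> f ` S \<in> U)"

definition small_cat :: "'u set set \<Rightarrow> ('o, 'a) cat \<Rightarrow> bool" where
  "small_cat U C \<longleftrightarrow> small_set U (Obj C) \<and> small_set U (Arr C)"

datatype 'u set_map = Set_Map (src: "'u set") (fn: "'u \<Rightarrow> 'u") (tgt: "'u set")

definition set_cat :: "'u set set \<Rightarrow> ('u set, 'u set_map) cat" where
  "set_cat U =
    \<lparr>Obj = U,
     Arr = {f. src f \<in> U \<and> tgt f \<in> U \<and> fn f \<in> src f \<rightarrow>\<^sub>E tgt f},
     Dom = src,
     Cod = tgt,
     Id = \<lambda>X. Set_Map X (\<lambda>x\<in>X. x) X,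
     Comp = \<lambda>g f. Set_Map (src f) (compose (src f) (fn g) (fn f)) (tgt g)\<rparr>"

type_synonym 'u set_functor = "('u set, 'u set_map, 'u set, 'u set_map) func"
type_synonym 'u set_nat_trans = "('u set, 'u set_map, 'u set, 'u set_map) nat_trans"

abbreviation set_functor_cat ::
  "'u set set \<Rightarrow> ('u set_functor, 'u set_nat_trans) cat" where
  "set_functor_cat U \<equiv> functor_cat (set_cat U) (set_cat U)"


section \<open>Taut functors and taut transformations\<close>

definition taut_functor :: "'u set set \<Rightarrow> 'u set_functor \<Rightarrow> bool" where
  "taut_functor U F \<longleftrightarrow> is_functor (set_cat U) (set_cat U) F \<and>
    (\<forall>p q f m. is_mono (set_cat U) m \<and> is_pullback (set_cat U) p q f m \<longrightarrow>
      is_pullback (set_cat U) (AMap F p) (AMap F q) (AMap F f) (AMap F m))"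

definition taut_nat_trans :: "'u set set \<Rightarrow> 'u set_nat_trans \<Rightarrow> bool" where
  "taut_nat_trans U t \<longleftrightarrow> is_nat_trans (set_cat U) (set_cat U) t \<and>
    (\<forall>m. is_mono (set_cat U) m \<longrightarrow>
      is_pullback (set_cat U)
        (AMap (NDom t) m) (NMap t (src m)) (NMap t (tgt m)) (AMap (NCod t) m))"

definition taut_cat :: "'u set set \<Rightarrow> ('u set_functor, 'u set_nat_trans) cat" where
  "taut_cat U = (set_functor_cat U)
    \<lparr>Obj := {F. taut_functor U F},
     Arr := {t. taut_functor U (NDom t) \<and> taut_functor U (NCod t) \<and> taut_nat_trans U t}\<rparr>"


section \<open>The difference functor\<close>

text \<open>The coproduct \<open>X + 1\<close> is realised inside \<open>'u\<close> through a fixed injection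
  \<open>'u option \<Rightarrow> 'u\<close>, which exists whenever \<open>'u\<close> is infinite.\<close>

definition enc :: "'u option \<Rightarrow> 'u" where
  "enc = (SOME e. inj e)"

definition plus1 :: "'u set \<Rightarrow> 'u set" where
  "plus1 X = enc ` insert None (Some ` X)"

definition inj1 :: "'u set \<Rightarrow> 'u set_map" where
  "inj1 X = Set_Map X (\<lambda>x\<in>X. enc (Some x)) (plus1 X)"

definition plus1_map :: "'u set_map \<Rightarrow> 'u set_map" where
  "plus1_map f = Set_Map (plus1 (src f))
    (\<lambda>y\<in>plus1 (src f). enc (map_option (fn f) (inv enc y))) (plus1 (tgt f))"

definition diff_set :: "'u set_functor \<Rightarrow> 'u set \<Rightarrow> 'u set" where
  "diff_set F X = OMap F (plus1 X) - fn (AMap F (inj1 X)) ` OMap F X"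

definition diff_obj :: "'u set set \<Rightarrow> 'u set_functor \<Rightarrow> 'u set_functor" where
  "diff_obj U F =
    \<lparr>OMap = \<lambda>X\<in>U. diff_set F X,
     AMap = \<lambda>f\<in>Arr (set_cat U).
       Set_Map (diff_set F (src f))
         (restrict (fn (AMap F (plus1_map f))) (diff_set F (src f)))
         (diff_set F (tgt f))\<rparr>"

definition diff_arr :: "'u set set \<Rightarrow> 'u set_nat_trans \<Rightarrow> 'u set_nat_trans" where
  "diff_arr U t =
    \<lparr>NDom = diff_obj U (NDom t),
     NCod = diff_obj U (NCod t),
     NMap = \<lambda>X\<in>U.
       Set_Map (diff_set (NDom t) X)
         (restrict (fn (NMap t (plus1 X))) (diff_set (NDom t) X))
         (diff_set (NCod t) X)\<rparr>"

definition Delta ::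
  "'u set set \<Rightarrow> ('u set_functor, 'u set_nat_trans, 'u set_functor, 'u set_nat_trans) func" where
  "Delta U =
    \<lparr>OMap = restrict (diff_obj U) (Obj (taut_cat U)),
     AMap = restrict (diff_arr U) (Arr (taut_cat U))\<rparr>"

end

theory Submission
  imports Defs
begin

text \<open>For a confluent diagram of sets, elements at stages \<open>i\<close> and \<open>j\<close> have the same image in the colimit
  iff they become equal at a common later stage. Hence a cocone of set functors is a colimit iff it is
  pointwise jointly surjective and identifies only such elements. This elementwise condition shows that
  a colimit of taut functors, together with its legs, is taut. A taut leg \<open>l\<^sub>i\<close> maps an element \<open>x\<close> of
  \<open>\<Gamma> i (X + 1)\<close> into the difference set of the colimit iff \<open>x\<close> lies in the difference set of \<open>\<Gamma> i\<close>, so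
  \<open>\<Delta>\<close> of the colimit cocone satisfies the same elementwise condition and is therefore a colimit
  cocone. Finally, a natural isomorphism between taut functors is taut.\<close>

section \<open>Sets and functors elementwise\<close>

text \<open>Colimits are taken among all functors, whereas the isomorphism is claimed in Taut, so
  the given colimits and the comparison both have to be shown taut. A universal property does not
  display elements; it is made elementwise by building one colimit explicitly and comparing an
  arbitrary one with it. Elements of every set have type \<open>'u\<close>, so equivalence classes
  cannot be the elements of the explicit colimit and are replaced by coded representatives. The same
  analysis has to apply to the diagram of differences, which is why \<Delta> is proved to be an
  endofunctor of Taut. Tautness of a transformation enters as a lifting property: along an injection
  from A to B, an element over B whose image comes from A comes itself from A.\<close>

abbreviation ap :: "'u set_functor \<Rightarrow> 'u set_map \<Rightarrow> 'u \<Rightarrow> 'u" where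
  "ap F f \<equiv> fn (AMap F f)"

abbreviation cm :: "'u set_nat_trans \<Rightarrow> 'u set \<Rightarrow> 'u \<Rightarrow> 'u" where
  "cm t X \<equiv> fn (NMap t X)"

lemma set_cat_simps [simp]:
  "Obj (set_cat U) = U"
  "Dom (set_cat U) = src"
  "Cod (set_cat U) = tgt"
  "Id (set_cat U) X = Set_Map X (\<lambda>x\<in>X. x) X"
  "Comp (set_cat U) g f = Set_Map (src f) (compose (src f) (fn g) (fn f)) (tgt g)"
  by (simp_all add: set_cat_def)

lemma arr_set_cat:
  "f \<in> Arr (set_cat U) \<longleftrightarrow> src f \<in> U \<and> tgt f \<in> U \<and> fn f \<in> src f \<rightarrow>\<^sub>E tgt f"
  by (simp add: set_cat_def)

lemma hom_set_cat:
  "f \<in> Hom (set_cat U) X Y \<longleftrightarrow>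
    X \<in> U \<and> Y \<in> U \<and> src f = X \<and> tgt f = Y \<and> fn f \<in> X \<rightarrow>\<^sub>E Y"
  by (auto simp: Hom_def arr_set_cat)

lemma arr_hom: "f \<in> Arr C \<longleftrightarrow> f \<in> Hom C (Dom C f) (Cod C f)"
  by (simp add: Hom_def)

lemma fn_in: "f \<in> Hom (set_cat U) X Y \<Longrightarrow> x \<in> X \<Longrightarrow> fn f x \<in> Y"
  by (auto simp: hom_set_cat)

lemma fn_Comp: "f \<in> Hom (set_cat U) X Y \<Longrightarrow> x \<in> X \<Longrightarrow> fn (Comp (set_cat U) g f) x = fn g (fn f x)"
  by (auto simp: hom_set_cat compose_def)

text \<open>Functions in a hom-set are extensional outside X, so their values on X determine
  them.\<close>

lemma set_map_eqI:
  assumes "f \<in> Hom (set_cat U) X Y" "g \<in> Hom (set_cat U) X Y"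
    and "\<And>x. x \<in> X \<Longrightarrow> fn f x = fn g x"
  shows "f = g"
  using assms by (intro set_map.expand) (auto simp: hom_set_cat intro: PiE_ext)

lemma category_set_cat: "category (set_cat U)"
proof
  fix f g h :: "'a set_map" and W X Y Z
  show "f \<in> Arr (set_cat U) \<Longrightarrow> Dom (set_cat U) f \<in> Obj (set_cat U)"
    "f \<in> Arr (set_cat U) \<Longrightarrow> Cod (set_cat U) f \<in> Obj (set_cat U)"
    "X \<in> Obj (set_cat U) \<Longrightarrow> Id (set_cat U) X \<in> Hom (set_cat U) X X"
    by (auto simp: arr_set_cat hom_set_cat)
  show "f \<in> Hom (set_cat U) X Y \<Longrightarrow> g \<in> Hom (set_cat U) Y Z \<Longrightarrow>
      Comp (set_cat U) g f \<in> Hom (set_cat U) X Z" for X Y Z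
    by (auto simp: hom_set_cat compose_def)
  show "f \<in> Hom (set_cat U) X Y \<Longrightarrow> Comp (set_cat U) f (Id (set_cat U) X) = f"
    by (rule set_map_eqI[of _ U X Y]) (auto simp: hom_set_cat compose_def)
  show "f \<in> Hom (set_cat U) X Y \<Longrightarrow> Comp (set_cat U) (Id (set_cat U) Y) f = f"
    by (rule set_map_eqI[of _ U X Y]) (auto simp: hom_set_cat compose_def)
  show "f \<in> Hom (set_cat U) W X \<Longrightarrow> g \<in> Hom (set_cat U) X Y \<Longrightarrow> h \<in> Hom (set_cat U) Y Z \<Longrightarrow>
      Comp (set_cat U) h (Comp (set_cat U) g f) = Comp (set_cat U) (Comp (set_cat U) h g) f"
    by (rule set_map_eqI[of _ U W Z]) (auto simp: hom_set_cat compose_def PiE_iff Pi_iff)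
qed

section \<open>Set functors through their action on elements\<close>

lemma is_functorD:
  assumes "is_functor (set_cat U) (set_cat U) F"
  shows "X \<in> U \<Longrightarrow> OMap F X \<in> U"
    and "f \<in> Hom (set_cat U) X Y \<Longrightarrow> AMap F f \<in> Hom (set_cat U) (OMap F X) (OMap F Y)"
    and "f \<in> Arr (set_cat U) \<Longrightarrow>
      AMap F f \<in> Hom (set_cat U) (OMap F (src f)) (OMap F (tgt f))"
  using assms arr_hom[of f "set_cat U"] unfolding is_functor_def by (auto simp: hom_set_cat)

lemma src_tgt_ap:
  assumes "is_functor (set_cat U) (set_cat U) F" "f \<in> Arr (set_cat U)"
  shows "src (AMap F f) = OMap F (src f)" "tgt (AMap F f) = OMap F (tgt f)"
    "AMap F f \<in> Arr (set_cat U)"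
  using is_functorD(3)[OF assms] by (auto simp: hom_set_cat arr_set_cat)

lemma ap_in:
  assumes "is_functor (set_cat U) (set_cat U) F" "f \<in> Hom (set_cat U) X Y" "x \<in> OMap F X"
  shows "ap F f x \<in> OMap F Y"
  by (rule fn_in[OF is_functorD(2)[OF assms(1,2)] assms(3)])

lemma ap_id:
  assumes "is_functor (set_cat U) (set_cat U) F" "X \<in> U" "x \<in> OMap F X"
  shows "ap F (Id (set_cat U) X) x = x"
proof -
  have "AMap F (Id (set_cat U) X) = Id (set_cat U) (OMap F X)"
    using assms(1,2) unfolding is_functor_def by (metis set_cat_simps(1))
  then show ?thesis
    using assms(3) by simp
qed

lemma ap_comp:
  assumes "is_functor (set_cat U) (set_cat U) F"
    and "f \<in> Hom (set_cat U) X Y" "g \<in> Hom (set_cat U) Y Z" "x \<in> OMap F X"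
  shows "ap F (Comp (set_cat U) g f) x = ap F g (ap F f x)"
proof -
  have "AMap F (Comp (set_cat U) g f) = Comp (set_cat U) (AMap F g) (AMap F f)"
    using assms unfolding is_functor_def by blast
  moreover have "src (AMap F f) = OMap F X"
    using is_functorD(2)[OF assms(1,2)] by (simp add: hom_set_cat)
  ultimately show ?thesis
    using assms(4) by (simp add: compose_def)
qed

text \<open>Both composites from X to Z are one and the same arrow because they agree on elements.
  This carries a commutative square through F without naming the composites.\<close>

lemma ap_commute:
  assumes "is_functor (set_cat U) (set_cat U) F"
    and "f \<in> Hom (set_cat U) X Y" "g \<in> Hom (set_cat U) Y Z"
    and "f' \<in> Hom (set_cat U) X Y'" "g' \<in> Hom (set_cat U) Y' Z"
    and "\<And>x. x \<in> X \<Longrightarrow> fn g (fn f x) = fn g' (fn f' x)" and "x \<in> OMap F X"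
  shows "ap F g (ap F f x) = ap F g' (ap F f' x)"
proof -
  have "Comp (set_cat U) g f = Comp (set_cat U) g' f'"
    using assms category.comp_hom[OF category_set_cat]
    by (intro set_map_eqI[of _ U X Z]) (auto simp: hom_set_cat compose_def)
  then show ?thesis
    using ap_comp[OF assms(1-3,7)] ap_comp[OF assms(1,4,5,7)] by metis
qed

text \<open>Restriction and the bookkeeping of sources and targets are built in, so functoriality
  reduces to conditions on elements. The difference functor and the explicit colimit both have this
  form.\<close>

definition mk_functor ::
  "'u set set \<Rightarrow> ('u set \<Rightarrow> 'u set) \<Rightarrow> ('u set_map \<Rightarrow> 'u \<Rightarrow> 'u) \<Rightarrow> 'u set_functor" where
  "mk_functor U Ob act =
    \<lparr>OMap = \<lambda>X\<in>U. Ob X,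
     AMap = \<lambda>f\<in>Arr (set_cat U).
       Set_Map (Ob (src f)) (restrict (act f) (Ob (src f))) (Ob (tgt f))\<rparr>"

lemma mk_functor_simps [simp]:
  "X \<in> U \<Longrightarrow> OMap (mk_functor U Ob act) X = Ob X"
  "f \<in> Arr (set_cat U) \<Longrightarrow> AMap (mk_functor U Ob act) f =
    Set_Map (Ob (src f)) (restrict (act f) (Ob (src f))) (Ob (tgt f))"
  by (simp_all add: mk_functor_def)

lemma is_functor_mk:
  assumes "\<And>X. X \<in> U \<Longrightarrow> Ob X \<in> U"
    and act: "\<And>X Y f x. f \<in> Hom (set_cat U) X Y \<Longrightarrow> x \<in> Ob X \<Longrightarrow> act f x \<in> Ob Y"
    and act_id: "\<And>X x. X \<in> U \<Longrightarrow> x \<in> Ob X \<Longrightarrow> act (Id (set_cat U) X) x = x"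
    and act_comp: "\<And>X Y Z f g x. f \<in> Hom (set_cat U) X Y \<Longrightarrow> g \<in> Hom (set_cat U) Y Z \<Longrightarrow> x \<in> Ob X \<Longrightarrow>
      act (Comp (set_cat U) g f) x = act g (act f x)"
  shows "is_functor (set_cat U) (set_cat U) (mk_functor U Ob act)"
proof -
  let ?F = "mk_functor U Ob act"
  have hom: "AMap ?F f \<in> Hom (set_cat U) (OMap ?F X) (OMap ?F Y)"
    if "f \<in> Hom (set_cat U) X Y" for f X Y
  proof -
    have "f \<in> Arr (set_cat U)" "X \<in> U" "Y \<in> U" "src f = X" "tgt f = Y"
      using that by (auto simp: hom_set_cat arr_set_cat)
    then show ?thesis
      using act[OF that] assms(1) by (auto simp: hom_set_cat)
  qed
  have id: "AMap ?F (Id (set_cat U) X) = Id (set_cat U) (OMap ?F X)" if "X \<in> U" for X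
  proof -
    have "Id (set_cat U) X \<in> Arr (set_cat U)"
      using that by (auto simp: arr_set_cat)
    then show ?thesis
      using that act_id[OF that] by (auto simp: restrict_def)
  qed
  have comp: "AMap ?F (Comp (set_cat U) g f) = Comp (set_cat U) (AMap ?F g) (AMap ?F f)"
    if f: "f \<in> Hom (set_cat U) X Y" and g: "g \<in> Hom (set_cat U) Y Z" for f g X Y Z
  proof -
    have "Comp (set_cat U) g f \<in> Hom (set_cat U) X Z"
      by (rule category.comp_hom[OF category_set_cat f g])
    then have "Comp (set_cat U) g f \<in> Arr (set_cat U)" "f \<in> Arr (set_cat U)" "g \<in> Arr (set_cat U)"
      "src f = X" "tgt f = Y" "src g = Y" "tgt g = Z" "X \<in> U"
      using f g by (auto simp: Hom_def arr_set_cat)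
    then show ?thesis
      using act_comp[OF f g] act[OF f] by (auto simp: compose_def fun_eq_iff)
  qed
  have "OMap ?F \<in> U \<rightarrow>\<^sub>E U"
    using assms(1) by (auto simp: mk_functor_def)
  moreover have "AMap ?F \<in> Arr (set_cat U) \<rightarrow>\<^sub>E Arr (set_cat U)"
    using hom by (auto simp: Hom_def mk_functor_def)
  ultimately show ?thesis
    unfolding is_functor_def using hom id comp by auto
qed

section \<open>Natural transformations on elements and the functor category\<close>

lemma is_nat_transD:
  assumes "is_nat_trans (set_cat U) (set_cat U) t"
  shows "is_functor (set_cat U) (set_cat U) (NDom t)" "is_functor (set_cat U) (set_cat U) (NCod t)"
    "X \<in> U \<Longrightarrow> NMap t X \<in> Hom (set_cat U) (OMap (NDom t) X) (OMap (NCod t) X)"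
  using assms unfolding is_nat_trans_def by auto

lemma cm_in:
  assumes "is_nat_trans (set_cat U) (set_cat U) t" "X \<in> U" "x \<in> OMap (NDom t) X"
  shows "cm t X x \<in> OMap (NCod t) X"
  by (rule fn_in[OF is_nat_transD(3)[OF assms(1,2)] assms(3)])

lemma cm_natural:
  assumes t: "is_nat_trans (set_cat U) (set_cat U) t"
    and f: "f \<in> Hom (set_cat U) X Y" and "x \<in> OMap (NDom t) X"
  shows "cm t Y (ap (NDom t) f x) = ap (NCod t) f (cm t X x)"
proof -
  have "X \<in> U"
    using f by (simp add: hom_set_cat)
  have "Comp (set_cat U) (NMap t Y) (AMap (NDom t) f) = Comp (set_cat U) (AMap (NCod t) f) (NMap t X)"
    using t f unfolding is_nat_trans_def by blast
  moreover have "src (AMap (NDom t) f) = OMap (NDom t) X" "src (NMap t X) = OMap (NDom t) X"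
    using is_functorD(2)[OF is_nat_transD(1)[OF t] f] is_nat_transD(3)[OF t \<open>X \<in> U\<close>]
    by (auto simp: hom_set_cat)
  ultimately have "compose (OMap (NDom t) X) (cm t Y) (ap (NDom t) f) x =
      compose (OMap (NDom t) X) (ap (NCod t) f) (cm t X) x"
    by simp
  then show ?thesis
    using assms(3) by (simp add: compose_def)
qed

text \<open>Identities, composites, difference transformations, the legs of the explicit colimit and
  its mediating maps all have this form, so their naturality is checked on elements.\<close>

definition mk_nat_trans ::
  "'u set set \<Rightarrow> 'u set_functor \<Rightarrow> 'u set_functor \<Rightarrow> ('u set \<Rightarrow> 'u \<Rightarrow> 'u) \<Rightarrow> 'u set_nat_trans" where
  "mk_nat_trans U F G c = \<lparr>NDom = F, NCod = G,
    NMap = \<lambda>X\<in>U. Set_Map (OMap F X) (restrict (c X) (OMap F X)) (OMap G X)\<rparr>"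

lemma mk_nat_trans_simps [simp]:
  "NDom (mk_nat_trans U F G c) = F"
  "NCod (mk_nat_trans U F G c) = G"
  "X \<in> U \<Longrightarrow> NMap (mk_nat_trans U F G c) X =
    Set_Map (OMap F X) (restrict (c X) (OMap F X)) (OMap G X)"
  by (simp_all add: mk_nat_trans_def)

lemma is_nat_trans_mk:
  assumes F: "is_functor (set_cat U) (set_cat U) F" and G: "is_functor (set_cat U) (set_cat U) G"
    and c: "\<And>X x. X \<in> U \<Longrightarrow> x \<in> OMap F X \<Longrightarrow> c X x \<in> OMap G X"
    and nat: "\<And>X Y f x. f \<in> Hom (set_cat U) X Y \<Longrightarrow> x \<in> OMap F X \<Longrightarrow>
      c Y (ap F f x) = ap G f (c X x)"
  shows "is_nat_trans (set_cat U) (set_cat U) (mk_nat_trans U F G c)"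
proof -
  let ?t = "mk_nat_trans U F G c"
  have hom: "NMap ?t X \<in> Hom (set_cat U) (OMap F X) (OMap G X)" if "X \<in> U" for X
    using that c[OF that] is_functorD(1)[OF F that] is_functorD(1)[OF G that]
    by (auto simp: hom_set_cat)
  have "Comp (set_cat U) (NMap ?t Y) (AMap F f) = Comp (set_cat U) (AMap G f) (NMap ?t X)"
    if f: "f \<in> Hom (set_cat U) X Y" for X Y f
  proof (rule set_map_eqI)
    have XY: "X \<in> U" "Y \<in> U"
      using f by (auto simp: hom_set_cat)
    show "Comp (set_cat U) (NMap ?t Y) (AMap F f) \<in> Hom (set_cat U) (OMap F X) (OMap G Y)"
      "Comp (set_cat U) (AMap G f) (NMap ?t X) \<in> Hom (set_cat U) (OMap F X) (OMap G Y)"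
      using hom XY is_functorD(2)[OF F f] is_functorD(2)[OF G f]
        category.comp_hom[OF category_set_cat] by blast+
    show "fn (Comp (set_cat U) (NMap ?t Y) (AMap F f)) x =
        fn (Comp (set_cat U) (AMap G f) (NMap ?t X)) x" if "x \<in> OMap F X" for x
      using that XY nat[OF f that] is_functorD(2)[OF F f] ap_in[OF F f that]
      by (auto simp: compose_def hom_set_cat)
  qed
  moreover have "NMap ?t \<in> extensional U"
    by (simp add: mk_nat_trans_def)
  ultimately show ?thesis
    using hom F G unfolding is_nat_trans_def
    by (auto simp del: set_cat_simps(5) mk_nat_trans_simps(3))
qed

lemma nat_trans_eqI:
  assumes "is_nat_trans (set_cat U) (set_cat U) s" "is_nat_trans (set_cat U) (set_cat U) t"
    and "NDom s = NDom t" "NCod s = NCod t"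
    and "\<And>X x. X \<in> U \<Longrightarrow> x \<in> OMap (NDom s) X \<Longrightarrow> cm s X x = cm t X x"
  shows "s = t"
proof -
  have "NMap s X = NMap t X" if "X \<in> U" for X
    using that is_nat_transD(3)[OF assms(1) that] is_nat_transD(3)[OF assms(2) that] assms(3-)
    by (intro set_map_eqI) auto
  moreover have "NMap s \<in> extensional U" "NMap t \<in> extensional U"
    using assms(1,2) by (auto simp: is_nat_trans_def)
  ultimately have "NMap s = NMap t"
    by (intro extensionalityI[of _ U]) auto
  then show ?thesis
    using assms(3,4) by simp
qed

lemma functor_cat_simps [simp]:
  "Obj (functor_cat C D) = {F. is_functor C D F}"
  "Arr (functor_cat C D) = {t. is_nat_trans C D t}"
  "Dom (functor_cat C D) = NDom" "Cod (functor_cat C D) = NCod"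
  "NDom (Id (functor_cat C D) F) = F" "NCod (Id (functor_cat C D) F) = F"
  "NDom (Comp (functor_cat C D) s t) = NDom t" "NCod (Comp (functor_cat C D) s t) = NCod s"
  by (simp_all add: functor_cat_def)

lemma hom_functor_cat:
  "t \<in> Hom (functor_cat C D) F G \<longleftrightarrow> is_nat_trans C D t \<and> NDom t = F \<and> NCod t = G"
  by (simp add: Hom_def)

lemma cm_Comp:
  assumes "is_nat_trans (set_cat U) (set_cat U) t" "X \<in> U" "x \<in> OMap (NDom t) X"
  shows "cm (Comp (set_functor_cat U) s t) X x = cm s X (cm t X x)"
  using is_nat_transD(3)[OF assms(1,2)] assms(2,3)
  by (simp add: functor_cat_def compose_def hom_set_cat)

lemma cm_Id:
  assumes "X \<in> U" "x \<in> OMap F X"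
  shows "cm (Id (set_functor_cat U) F) X x = x"
  using assms by (simp add: functor_cat_def)

lemma is_nat_trans_Comp:
  assumes s: "is_nat_trans (set_cat U) (set_cat U) s" and t: "is_nat_trans (set_cat U) (set_cat U) t"
    and "NDom s = NCod t"
  shows "is_nat_trans (set_cat U) (set_cat U) (Comp (set_functor_cat U) s t)"
proof -
  have "Comp (set_functor_cat U) s t = mk_nat_trans U (NDom t) (NCod s) (\<lambda>X x. cm s X (cm t X x))"
    using is_nat_transD(3)[OF s] is_nat_transD(3)[OF t]
    by (auto simp: functor_cat_def mk_nat_trans_def hom_set_cat compose_def intro!: restrict_ext)
  also have "is_nat_trans (set_cat U) (set_cat U) \<dots>"
  proof (rule is_nat_trans_mk)
    fix X Y f x
    assume f: "f \<in> Hom (set_cat U) X Y" and x: "x \<in> OMap (NDom t) X"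
    then have "X \<in> U"
      by (simp add: hom_set_cat)
    then show "cm s Y (cm t Y (ap (NDom t) f x)) = ap (NCod s) f (cm s X (cm t X x))"
      using cm_natural[OF t f x] cm_natural[OF s f] cm_in[OF t _ x] assms(3) by simp
  qed (use assms in \<open>auto intro: is_nat_transD cm_in[OF s] simp: cm_in[OF t]\<close>)
  finally show ?thesis .
qed

lemma is_nat_trans_Id:
  assumes F: "is_functor (set_cat U) (set_cat U) F"
  shows "is_nat_trans (set_cat U) (set_cat U) (Id (set_functor_cat U) F)"
proof -
  have "Id (set_functor_cat U) F = mk_nat_trans U F F (\<lambda>X x. x)"
    by (simp add: functor_cat_def mk_nat_trans_def)
  then show ?thesis
    using is_nat_trans_mk[OF F F, of "\<lambda>X x. x"] by simp
qed

lemma category_set_functor_cat: "category (set_functor_cat U)"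
proof
  let ?C = "set_functor_cat U"
  fix f g h :: "'a set_nat_trans" and W X Y Z
  show "f \<in> Arr ?C \<Longrightarrow> Dom ?C f \<in> Obj ?C" "f \<in> Arr ?C \<Longrightarrow> Cod ?C f \<in> Obj ?C"
    by (auto dest: is_nat_transD)
  show "X \<in> Obj ?C \<Longrightarrow> Id ?C X \<in> Hom ?C X X"
    using is_nat_trans_Id by (auto simp: hom_functor_cat)
  show comp: "f \<in> Hom ?C X Y \<Longrightarrow> g \<in> Hom ?C Y Z \<Longrightarrow> Comp ?C g f \<in> Hom ?C X Z" for f g X Y Z
    using is_nat_trans_Comp[of U g f] by (auto simp: hom_functor_cat)
  show "Comp ?C f (Id ?C X) = f" if f: "f \<in> Hom ?C X Y"
  proof (rule nat_trans_eqI)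
    have X: "is_nat_trans (set_cat U) (set_cat U) (Id ?C X)"
      using f is_nat_trans_Id is_nat_transD(1) by (auto simp: hom_functor_cat)
    then show "is_nat_trans (set_cat U) (set_cat U) (Comp ?C f (Id ?C X))"
      using f by (intro is_nat_trans_Comp) (auto simp: hom_functor_cat)
    fix A x assume "A \<in> U" "x \<in> OMap (NDom (Comp ?C f (Id ?C X))) A"
    then show "cm (Comp ?C f (Id ?C X)) A x = cm f A x"
      using cm_Comp[OF X] cm_Id[of A U x X] by simp
  qed (use f in \<open>auto simp: hom_functor_cat\<close>)
  show "Comp ?C (Id ?C Y) f = f" if f: "f \<in> Hom ?C X Y"
  proof (rule nat_trans_eqI)
    show "is_nat_trans (set_cat U) (set_cat U) (Comp ?C (Id ?C Y) f)"
      using f is_nat_trans_Id is_nat_transD(2)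
      by (intro is_nat_trans_Comp) (auto simp: hom_functor_cat)
    fix A x assume "A \<in> U" "x \<in> OMap (NDom (Comp ?C (Id ?C Y) f)) A"
    then show "cm (Comp ?C (Id ?C Y) f) A x = cm f A x"
      using f cm_Comp[of U f A x "Id ?C Y"] cm_in[of U f A x] cm_Id[of A U _ Y]
      by (auto simp: hom_functor_cat)
  qed (use f in \<open>auto simp: hom_functor_cat\<close>)
  show "Comp ?C h (Comp ?C g f) = Comp ?C (Comp ?C h g) f"
    if f: "f \<in> Hom ?C W X" and g: "g \<in> Hom ?C X Y" and h: "h \<in> Hom ?C Y Z"
  proof (rule nat_trans_eqI)
    have nt: "is_nat_trans (set_cat U) (set_cat U) f" "is_nat_trans (set_cat U) (set_cat U) g"
      "is_nat_trans (set_cat U) (set_cat U) h"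
      "is_nat_trans (set_cat U) (set_cat U) (Comp ?C g f)"
      "is_nat_trans (set_cat U) (set_cat U) (Comp ?C h (Comp ?C g f))"
      "is_nat_trans (set_cat U) (set_cat U) (Comp ?C (Comp ?C h g) f)"
      using f g h comp[OF f g] comp[OF comp[OF f g] h] comp[OF f comp[OF g h]]
      unfolding hom_functor_cat by blast+
    show "is_nat_trans (set_cat U) (set_cat U) (Comp ?C h (Comp ?C g f))"
      "is_nat_trans (set_cat U) (set_cat U) (Comp ?C (Comp ?C h g) f)"
      by fact+
    fix A x assume A: "A \<in> U" and x: "x \<in> OMap (NDom (Comp ?C h (Comp ?C g f))) A"
    then have x: "x \<in> OMap (NDom f) A" "x \<in> OMap (NDom (Comp ?C g f)) A"
      "cm f A x \<in> OMap (NDom g) A"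
      using cm_in[OF nt(1) A] f g by (auto simp: hom_functor_cat)
    show "cm (Comp ?C h (Comp ?C g f)) A x = cm (Comp ?C (Comp ?C h g) f) A x"
      by (simp only: cm_Comp[OF nt(4) A x(2)] cm_Comp[OF nt(1) A x(1)] cm_Comp[OF nt(2) A x(3)])
  qed simp_all
qed

section \<open>Uniqueness of colimits\<close>

text \<open>The mediating arrows compose to endomorphisms that fix all legs, hence to identities.
  The equation with the legs is kept so that properties of a cocone can be transported along
  f.\<close>

lemma colimit_unique:
  assumes C: "category C" and L: "is_colimit I C D L l" and M: "is_colimit I C D M m"
  obtains f g where "f \<in> Hom C L M" "g \<in> Hom C M L" "Comp C g f = Id C L" "Comp C f g = Id C M"
    and "\<And>i. i \<in> Obj I \<Longrightarrow> Comp C f (l i) = m i"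
proof -
  interpret category C by (rule C)
  have endo_id: "Comp C g f = Id C L"
    if L: "is_colimit I C D L l" and f: "f \<in> Hom C L M" and g: "g \<in> Hom C M L"
      and fl: "\<forall>i\<in>Obj I. Comp C f (l i) = m i" and gm: "\<forall>i\<in>Obj I. Comp C g (m i) = l i"
    for L M l m f g
  proof -
    have l: "is_cocone I C D L l"
      using L by (simp add: is_colimit_def)
    then have uniq: "\<exists>!h. h \<in> Hom C L L \<and> (\<forall>i\<in>Obj I. Comp C h (l i) = l i)"
      using L unfolding is_colimit_def by blast
    have "L \<in> Obj C"
      using l by (simp add: is_cocone_def)
    have hom: "l i \<in> Hom C (OMap D i) L" if "i \<in> Obj I" for i
      using l that by (simp add: is_cocone_def)
    have "Comp C g f \<in> Hom C L L \<and> (\<forall>i\<in>Obj I. Comp C (Comp C g f) (l i) = l i)"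
      using comp_hom[OF f g] comp_assoc[OF hom f g] fl gm by metis
    moreover have "Id C L \<in> Hom C L L \<and> (\<forall>i\<in>Obj I. Comp C (Id C L) (l i) = l i)"
      using id_hom[OF \<open>L \<in> Obj C\<close>] comp_id_left[OF hom] by blast
    ultimately show "Comp C g f = Id C L"
      using uniq by blast
  qed
  have "is_cocone I C D L l" "is_cocone I C D M m"
    using L M by (simp_all add: is_colimit_def)
  then obtain f g where fg: "f \<in> Hom C L M" "\<forall>i\<in>Obj I. Comp C f (l i) = m i"
    "g \<in> Hom C M L" "\<forall>i\<in>Obj I. Comp C g (m i) = l i"
    using L M unfolding is_colimit_def by meson
  then show ?thesis
    using endo_id[OF L fg(1,3,2,4)] endo_id[OF M fg(3,1,4,2)] by (intro that[of f g]) auto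
qed

section \<open>Pullbacks of sets and tautness\<close>

text \<open>The elementwise notion: one element over each compatible pair. Membership of the four
  maps in \<open>Arr\<close> is left to \<open>pullback_iff\<close>.\<close>

definition set_pullback :: "'u set_map \<Rightarrow> 'u set_map \<Rightarrow> 'u set_map \<Rightarrow> 'u set_map \<Rightarrow> bool" where
  "set_pullback p q f g \<longleftrightarrow> src p = src q \<and> tgt p = src f \<and> tgt q = src g \<and> tgt f = tgt g \<and>
    (\<forall>u\<in>src p. fn f (fn p u) = fn g (fn q u)) \<and>
    (\<forall>a\<in>src f. \<forall>b\<in>src g. fn f a = fn g b \<longrightarrow>
      (\<exists>!u. u \<in> src p \<and> fn p u = a \<and> fn q u = b))"

text \<open>Elements with the same image under p have images under q that m identifies; injectivity
  of m makes these equal, and the uniqueness part of the pullback concludes.\<close>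

lemma set_pullback_inj:
  assumes "set_pullback p q f m" "inj_on (fn m) (src m)" "p \<in> Arr (set_cat U)" "q \<in> Arr (set_cat U)"
  shows "inj_on (fn p) (src p)"
proof (rule inj_onI)
  fix u v assume uv: "u \<in> src p" "v \<in> src p" "fn p u = fn p v"
  have "fn p u \<in> src f" "fn q u \<in> src m" "fn q v \<in> src m"
    using assms uv unfolding set_pullback_def arr_set_cat by (metis PiE_mem)+
  moreover have "fn f (fn p u) = fn m (fn q u)" "fn f (fn p v) = fn m (fn q v)"
    using assms(1) uv(1,2) unfolding set_pullback_def by blast+
  ultimately show "u = v"
    using assms(1,2) uv unfolding set_pullback_def inj_on_def by metis
qed

text \<open>An injective p determines u from its image alone, so of the pullback property only
  existence remains.\<close>

lemma set_pullback_monoI: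
  assumes "src p = src q" "tgt p = src f" "tgt q = src m" "tgt f = tgt m"
    and comm: "\<And>u. u \<in> src p \<Longrightarrow> fn f (fn p u) = fn m (fn q u)"
    and "inj_on (fn p) (src p)"
    and "\<And>a b. a \<in> src f \<Longrightarrow> b \<in> src m \<Longrightarrow> fn f a = fn m b \<Longrightarrow>
      \<exists>u. u \<in> src p \<and> fn p u = a \<and> fn q u = b"
  shows "set_pullback p q f m"
  using assms unfolding set_pullback_def inj_on_def by metis

context set_universe
begin

abbreviation S where "S \<equiv> set_cat U"

text \<open>A map out of a one-element set stands for an element. The element w of the domain is a
  parameter because no terminal object has been fixed.\<close>

definition point :: "'u \<Rightarrow> 'u \<Rightarrow> 'u set \<Rightarrow> 'u set_map" where
  "point w x Y = Set_Map {w} (\<lambda>_\<in>{w}. x) Y"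

lemma point_simps [simp]: "src (point w x Y) = {w}" "tgt (point w x Y) = Y" "fn (point w x Y) w = x"
  by (simp_all add: point_def)

text \<open>A singleton arises as the image of a nonempty member under a constant map.\<close>

lemma singleton_in: "{x} \<in> U"
proof -
  obtain N where "N \<in> U" "infinite N"
    using infinite_member by blast
  then have "(\<lambda>_. x) ` N \<in> U" "N \<noteq> {}"
    using image_closed by auto
  then show ?thesis
    by (simp add: image_constant_conv)
qed

lemma point_hom: "Y \<in> U \<Longrightarrow> x \<in> Y \<Longrightarrow> point w x Y \<in> Hom S {w} Y"
  using singleton_in by (auto simp: hom_set_cat point_def)

lemma Comp_point:
  assumes "f \<in> Hom S X Y" "x \<in> X"
  shows "Comp S f (point w x X) = point w (fn f x) Y"
  using assms by (auto simp: hom_set_cat point_def compose_def)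

text \<open>Cancellation is tested on points with a common one-element domain; conversely an
  injective m is cancelled at every element.\<close>

lemma mono_iff: "is_mono S m \<longleftrightarrow> m \<in> Arr S \<and> inj_on (fn m) (src m)"
proof (cases "m \<in> Arr S")
  case True
  then have m: "m \<in> Hom S (src m) (tgt m)"
    by (simp add: Hom_def)
  have "inj_on (fn m) (src m)"
    if mono: "\<And>W u v. u \<in> Hom S W (src m) \<Longrightarrow> v \<in> Hom S W (src m) \<Longrightarrow>
      Comp S m u = Comp S m v \<Longrightarrow> u = v"
  proof (rule inj_onI)
    fix x y assume xy: "x \<in> src m" "y \<in> src m" "fn m x = fn m y"
    have "src m \<in> U"
      using m by (simp add: hom_set_cat)
    have "Comp S m (point x x (src m)) = Comp S m (point x y (src m))"
      by (simp only: Comp_point[OF m xy(1)] Comp_point[OF m xy(2)] xy(3))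
    then have "point x x (src m) = point x y (src m)"
      by (rule mono[OF point_hom[OF \<open>src m \<in> U\<close> xy(1)] point_hom[OF \<open>src m \<in> U\<close> xy(2)]])
    then show "x = y"
      by (metis point_simps(3))
  qed
  moreover have "u = v" if inj: "inj_on (fn m) (src m)"
    and u: "u \<in> Hom S W (src m)" and v: "v \<in> Hom S W (src m)"
    and eq: "Comp S m u = Comp S m v" for W u v
  proof (rule set_map_eqI[OF u v])
    fix w assume w: "w \<in> W"
    have "fn m (fn u w) = fn m (fn v w)"
      using fn_Comp[OF u w] fn_Comp[OF v w] eq by metis
    then show "fn u w = fn v w"
      using fn_in[OF u w] fn_in[OF v w] inj by (simp add: inj_on_def)
  qed
  ultimately show ?thesis
    unfolding is_mono_def set_cat_simps(2) by (smt (verit) True)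
qed (simp add: is_mono_def)

text \<open>The universal property at one-element domains gives the elementwise condition.
  Conversely the unique lifts of all elements of W form the mediating map.\<close>

lemma pullback_iff:
  "is_pullback S p q f g \<longleftrightarrow> {p, q, f, g} \<subseteq> Arr S \<and> set_pullback p q f g"
\<comment> \<open>If the maps are not arrows or do not fit together, both sides are false.\<close>
proof (cases "{p, q, f, g} \<subseteq> Arr S \<and> src p = src q \<and> tgt p = src f \<and> tgt q = src g \<and> tgt f = tgt g")
  case True
  then have p: "p \<in> Hom S (src p) (src f)" and q: "q \<in> Hom S (src p) (src g)"
    and f: "f \<in> Hom S (src f) (tgt f)" and g: "g \<in> Hom S (src g) (tgt f)"
    by (auto simp: Hom_def)
  then have U: "src p \<in> U" "src f \<in> U" "src g \<in> U"
    by (auto simp: hom_set_cat)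
  have comm: "Comp S f p = Comp S g q \<longleftrightarrow> (\<forall>u\<in>src p. fn f (fn p u) = fn g (fn q u))"
    using True by (auto simp: compose_def fun_eq_iff restrict_def)
  have to_pb: "\<exists>!u. u \<in> src p \<and> fn p u = a \<and> fn q u = b"
    if univ: "\<And>W \<alpha> \<beta>. \<alpha> \<in> Hom S W (src f) \<Longrightarrow> \<beta> \<in> Hom S W (src g) \<Longrightarrow>
        Comp S f \<alpha> = Comp S g \<beta> \<Longrightarrow> \<exists>!u. u \<in> Hom S W (src p) \<and> Comp S p u = \<alpha> \<and> Comp S q u = \<beta>"
      and ab: "a \<in> src f" "b \<in> src g" "fn f a = fn g b" for a b
  proof -
    have "Comp S f (point a a (src f)) = Comp S g (point a b (src g))"
      by (simp only: Comp_point[OF f ab(1)] Comp_point[OF g ab(2)] ab(3))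
    then have "\<exists>!u. u \<in> Hom S {a} (src p) \<and>
        Comp S p u = point a a (src f) \<and> Comp S q u = point a b (src g)"
      using univ point_hom[OF U(2) ab(1)] point_hom[OF U(3) ab(2)] by blast
    then obtain u where u: "u \<in> Hom S {a} (src p)"
        "Comp S p u = point a a (src f)" "Comp S q u = point a b (src g)"
      and uniq: "\<And>v. v \<in> Hom S {a} (src p) \<Longrightarrow> Comp S p v = point a a (src f) \<Longrightarrow>
        Comp S q v = point a b (src g) \<Longrightarrow> v = u"
      by metis
    \<comment> \<open>An arrow out of \<open>{a}\<close> is determined by its value, so the
      mediating arrow amounts to an element of \<open>src p\<close>.\<close>
    have "u = point a (fn u a) (src p)"
      using u(1) fn_in[OF u(1)] U by (intro set_map_eqI[OF u(1)] point_hom) auto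
    moreover have ua: "fn u a \<in> src p"
      using fn_in[OF u(1)] by simp
    ultimately have "point a (fn p (fn u a)) (src f) = point a a (src f)"
      "point a (fn q (fn u a)) (src g) = point a b (src g)"
      using u(2,3) Comp_point[OF p ua] Comp_point[OF q ua] by metis+
    then have "fn p (fn u a) = a" "fn q (fn u a) = b"
      by (metis point_simps(3))+
    moreover have "v = fn u a" if "v \<in> src p" "fn p v = a" "fn q v = b" for v
    proof -
      have "point a v (src p) = u"
        using that(2,3) Comp_point[OF p that(1)] Comp_point[OF q that(1)]
        by (intro uniq point_hom[OF U(1) that(1)]) metis+
      then show ?thesis
        by (metis point_simps(3))
    qed
    ultimately show ?thesis
      using ua by blast
  qed
  have from_pb: "\<exists>!u. u \<in> Hom S W (src p) \<and> Comp S p u = \<alpha> \<and> Comp S q u = \<beta>"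
    if pb: "set_pullback p q f g" and \<alpha>: "\<alpha> \<in> Hom S W (src f)" and \<beta>: "\<beta> \<in> Hom S W (src g)"
      and eq: "Comp S f \<alpha> = Comp S g \<beta>" for W \<alpha> \<beta>
  proof -
    have "\<exists>!u. u \<in> src p \<and> fn p u = fn \<alpha> w \<and> fn q u = fn \<beta> w" if w: "w \<in> W" for w
    proof -
      have "fn f (fn \<alpha> w) = fn g (fn \<beta> w)"
        using fn_Comp[OF \<alpha> w] fn_Comp[OF \<beta> w] eq by metis
      then show ?thesis
        using pb fn_in[OF \<alpha> w] fn_in[OF \<beta> w] unfolding set_pullback_def by blast
    qed
    \<comment> \<open>The lifts are collected into one function; its uniqueness at each w later
      yields uniqueness of the mediating arrow.\<close>
    then obtain h where h: "\<And>w. w \<in> W \<Longrightarrow> h w \<in> src p \<and> fn p (h w) = fn \<alpha> w \<and> fn q (h w) = fn \<beta> w"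
      and uniq: "\<And>w u. w \<in> W \<Longrightarrow> u \<in> src p \<Longrightarrow> fn p u = fn \<alpha> w \<Longrightarrow> fn q u = fn \<beta> w \<Longrightarrow> u = h w"
      by metis
    define u where "u = Set_Map W (restrict h W) (src p)"
    have W: "W \<in> U"
      using \<alpha> by (simp add: hom_set_cat)
    have u: "u \<in> Hom S W (src p)"
      using h W U by (auto simp: u_def hom_set_cat)
    have "Comp S p u = \<alpha>" "Comp S q u = \<beta>"
      using h category.comp_hom[OF category_set_cat u p] category.comp_hom[OF category_set_cat u q]
      by (intro set_map_eqI[OF _ \<alpha>] set_map_eqI[OF _ \<beta>]; simp add: u_def compose_def)+
    moreover have "v = u" if v: "v \<in> Hom S W (src p)" "Comp S p v = \<alpha>" "Comp S q v = \<beta>" for v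
    proof (rule set_map_eqI[OF v(1) u])
      fix w assume w: "w \<in> W"
      have "fn p (fn v w) = fn \<alpha> w" "fn q (fn v w) = fn \<beta> w"
        using fn_Comp[OF v(1) w] v(2,3) by metis+
      then show "fn v w = fn u w"
        using uniq[OF w fn_in[OF v(1) w]] w by (simp add: u_def)
    qed
    ultimately show ?thesis
      using u by blast
  qed
  show ?thesis
  proof
    assume *: "is_pullback S p q f g"
    then have "\<And>W \<alpha> \<beta>. \<alpha> \<in> Hom S W (src f) \<Longrightarrow> \<beta> \<in> Hom S W (src g) \<Longrightarrow>
        Comp S f \<alpha> = Comp S g \<beta> \<Longrightarrow> \<exists>!u. u \<in> Hom S W (src p) \<and> Comp S p u = \<alpha> \<and> Comp S q u = \<beta>"
      unfolding is_pullback_def set_cat_simps(2,3) by blast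
    then have "\<forall>a\<in>src f. \<forall>b\<in>src g. fn f a = fn g b \<longrightarrow> (\<exists>!u. u \<in> src p \<and> fn p u = a \<and> fn q u = b)"
      using to_pb by blast
    moreover have "Comp S f p = Comp S g q"
      using * by (simp only: is_pullback_def)
    ultimately show "{p, q, f, g} \<subseteq> Arr S \<and> set_pullback p q f g"
      unfolding comm set_pullback_def using True by blast
  next
    assume *: "{p, q, f, g} \<subseteq> Arr S \<and> set_pullback p q f g"
    show "is_pullback S p q f g"
      unfolding is_pullback_def set_cat_simps(2,3)
    proof (intro conjI allI ballI impI)
      show "{p, q, f, g} \<subseteq> Arr S" "src p = src q" "tgt p = src f" "tgt q = src g" "tgt f = tgt g"
        using True by (simp_all only:)
      show "Comp S f p = Comp S g q"
        using * unfolding comm set_pullback_def by blast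
      show "\<exists>!u. u \<in> Hom S W (src p) \<and> Comp S p u = \<alpha> \<and> Comp S q u = \<beta>"
        if "\<alpha> \<in> Hom S W (src f)" "\<beta> \<in> Hom S W (src g)" "Comp S f \<alpha> = Comp S g \<beta>" for W \<alpha> \<beta>
        using from_pb[OF _ that] * by blast
    qed
  qed
next
  case False
  then show ?thesis
    unfolding is_pullback_def set_pullback_def set_cat_simps(2,3) by blast
qed

section \<open>Elementwise criteria for taut functors and taut transformations\<close>

lemma arr_of_hom: "f \<in> Hom S X Y \<Longrightarrow> f \<in> Arr S \<and> src f = X \<and> tgt f = Y"
  by (simp add: Hom_def)

text \<open>The leg p is injective along with m, so \<open>inj\<close> makes its image under F
  injective, and uniqueness of the lift in \<open>ex\<close> comes for free.\<close>

lemma taut_functorI: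
  assumes F: "is_functor S S F"
    and inj: "\<And>m. m \<in> Arr S \<Longrightarrow> inj_on (fn m) (src m) \<Longrightarrow> inj_on (ap F m) (OMap F (src m))"
    and ex: "\<And>p q f m a b. {p, q, f, m} \<subseteq> Arr S \<Longrightarrow> inj_on (fn m) (src m) \<Longrightarrow> set_pullback p q f m \<Longrightarrow>
      a \<in> OMap F (src f) \<Longrightarrow> b \<in> OMap F (src m) \<Longrightarrow> ap F f a = ap F m b \<Longrightarrow>
      \<exists>u. u \<in> OMap F (src p) \<and> ap F p u = a \<and> ap F q u = b"
  shows "taut_functor U F"
  unfolding taut_functor_def mono_iff pullback_iff
proof (intro conjI allI impI)
  fix p q f m
  assume *: "(m \<in> Arr S \<and> inj_on (fn m) (src m)) \<and> {p, q, f, m} \<subseteq> Arr S \<and> set_pullback p q f m"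
  then have arr: "p \<in> Arr S" "q \<in> Arr S" "f \<in> Arr S" "m \<in> Arr S"
    by simp_all
  note F_arr = arr[THEN src_tgt_ap(1)[OF F]] arr[THEN src_tgt_ap(2)[OF F]]
  show "{AMap F p, AMap F q, AMap F f, AMap F m} \<subseteq> Arr S"
    using arr src_tgt_ap(3)[OF F] by simp
  have sq: "src p = src q" "tgt p = src f" "tgt q = src m" "tgt f = tgt m"
    and comm: "\<And>u. u \<in> src p \<Longrightarrow> fn f (fn p u) = fn m (fn q u)"
    using * unfolding set_pullback_def by blast+
  have hom: "p \<in> Hom S (src p) (src f)" "f \<in> Hom S (src f) (tgt f)"
    "q \<in> Hom S (src p) (src m)" "m \<in> Hom S (src m) (tgt f)"
    using arr sq by (simp_all add: Hom_def)
  show "set_pullback (AMap F p) (AMap F q) (AMap F f) (AMap F m)"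
  proof (rule set_pullback_monoI)
    show "ap F f (ap F p u) = ap F m (ap F q u)" if "u \<in> src (AMap F p)" for u
      using that comm unfolding F_arr by (intro ap_commute[OF F hom])
    show "inj_on (ap F p) (src (AMap F p))"
      unfolding F_arr using * set_pullback_inj[of p q f m U] arr by (intro inj) auto
    show "\<exists>u. u \<in> src (AMap F p) \<and> ap F p u = a \<and> ap F q u = b"
      if "a \<in> src (AMap F f)" "b \<in> src (AMap F m)" "ap F f a = ap F m b" for a b
      using that * unfolding F_arr by (intro ex[of p q f m a b]) simp_all
  qed (simp_all only: F_arr sq)
qed (rule F)

lemma taut_functor_is_functor: "taut_functor U F \<Longrightarrow> is_functor S S F"
  by (simp add: taut_functor_def)

lemma taut_functor_pb:
  assumes F: "taut_functor U F"
    and arr: "{p, q, f, m} \<subseteq> Arr S" and m: "inj_on (fn m) (src m)" and pb: "set_pullback p q f m"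
    and ab: "a \<in> OMap F (src f)" "b \<in> OMap F (src m)" "ap F f a = ap F m b"
  shows "\<exists>!u. u \<in> OMap F (src p) \<and> ap F p u = a \<and> ap F q u = b"
proof -
  have "is_mono S m \<and> is_pullback S p q f m"
    using arr m pb by (simp only: mono_iff pullback_iff) simp
  then have "set_pullback (AMap F p) (AMap F q) (AMap F f) (AMap F m)"
    using F unfolding taut_functor_def pullback_iff by blast
  moreover have "src (AMap F p) = OMap F (src p)" "src (AMap F f) = OMap F (src f)"
    "src (AMap F m) = OMap F (src m)"
    using arr src_tgt_ap(1)[OF taut_functor_is_functor[OF F]] by simp_all
  ultimately show ?thesis
    using ab unfolding set_pullback_def by metis
qed

text \<open>For injective m the kernel pair is trivial, so the square on m, m with two identities is
  a pullback. Its image under F yields one u that is sent to both x and y by the same map.\<close>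

lemma taut_functor_inj:
  assumes F: "taut_functor U F" and m: "m \<in> Arr S" "inj_on (fn m) (src m)"
  shows "inj_on (ap F m) (OMap F (src m))"
proof (rule inj_onI)
  fix x y assume xy: "x \<in> OMap F (src m)" "y \<in> OMap F (src m)" "ap F m x = ap F m y"
  let ?i = "Id S (src m)"
  have i: "?i \<in> Arr S" "src m \<in> U"
    using m(1) by (auto simp: arr_set_cat)
  have "set_pullback ?i ?i m m"
    using m(2) unfolding set_pullback_def by (auto dest: inj_onD)
  then have "\<exists>!u. u \<in> OMap F (src ?i) \<and> ap F ?i u = x \<and> ap F ?i u = y"
    using m i xy by (intro taut_functor_pb[OF F]) auto
  then show "x = y"
    by blast
qed

text \<open>Tautness of the domain functor makes its value at m injective, so existence of a lift
  suffices for the naturality square to be a pullback.\<close>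

lemma taut_nat_transI:
  assumes t: "is_nat_trans S S t" and dom: "taut_functor U (NDom t)"
    and ex: "\<And>A B m y z. m \<in> Hom S A B \<Longrightarrow> inj_on (fn m) A \<Longrightarrow>
      y \<in> OMap (NDom t) B \<Longrightarrow> z \<in> OMap (NCod t) A \<Longrightarrow>
      cm t B y = ap (NCod t) m z \<Longrightarrow>
      \<exists>u. u \<in> OMap (NDom t) A \<and> ap (NDom t) m u = y \<and> cm t A u = z"
  shows "taut_nat_trans U t"
  unfolding taut_nat_trans_def mono_iff pullback_iff
proof (intro conjI allI impI)
  fix m assume m: "m \<in> Arr S \<and> inj_on (fn m) (src m)"
  then have hom: "m \<in> Hom S (src m) (tgt m)" and U: "src m \<in> U" "tgt m \<in> U"
    by (auto simp: Hom_def arr_set_cat)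
  note F = is_nat_transD(1)[OF t] and G = is_nat_transD(2)[OF t]
  have comps: "NMap t X \<in> Arr S" "src (NMap t X) = OMap (NDom t) X"
    "tgt (NMap t X) = OMap (NCod t) X" if "X \<in> U" for X
    using arr_of_hom[OF is_nat_transD(3)[OF t that]] by auto
  note simps = comps[OF U(1)] comps[OF U(2)] src_tgt_ap[OF F conjunct1[OF m]]
    src_tgt_ap[OF G conjunct1[OF m]]
  show "{AMap (NDom t) m, NMap t (src m), NMap t (tgt m), AMap (NCod t) m} \<subseteq> Arr S"
    by (simp add: simps)
  show "set_pullback (AMap (NDom t) m) (NMap t (src m)) (NMap t (tgt m)) (AMap (NCod t) m)"
    using cm_natural[OF t hom] taut_functor_inj[OF dom] m ex[OF hom]
    by (intro set_pullback_monoI) (simp_all only: simps)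
qed (rule t)

text \<open>Extracts the existence half of the pullback, the form in which tautness of a
  transformation is used below.\<close>

lemma taut_nat_transD:
  assumes "taut_nat_trans U t" and m: "m \<in> Hom S A B" "inj_on (fn m) A"
    and "y \<in> OMap (NDom t) B" "z \<in> OMap (NCod t) A" "cm t B y = ap (NCod t) m z"
  shows "\<exists>u. u \<in> OMap (NDom t) A \<and> ap (NDom t) m u = y \<and> cm t A u = z"
proof -
  have t: "is_nat_trans S S t"
    using assms(1) by (simp add: taut_nat_trans_def)
  note F = is_nat_transD(1)[OF t] and G = is_nat_transD(2)[OF t]
  have m': "m \<in> Arr S" "src m = A" "tgt m = B" and U: "A \<in> U" "B \<in> U"
    using m by (auto simp: hom_set_cat arr_set_cat)
  then have "is_mono S m"
    using m by (simp add: mono_iff)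
  then have "set_pullback (AMap (NDom t) m) (NMap t A) (NMap t B) (AMap (NCod t) m)"
    using assms(1) m' unfolding taut_nat_trans_def pullback_iff by blast
  moreover have "src (AMap (NDom t) m) = OMap (NDom t) A" "src (AMap (NCod t) m) = OMap (NCod t) A"
    "src (NMap t B) = OMap (NDom t) B"
    using src_tgt_ap[OF F m'(1)] src_tgt_ap[OF G m'(1)] arr_of_hom[OF is_nat_transD(3)[OF t U(2)]] m'
    by auto
  ultimately show ?thesis
    using assms(4-6) unfolding set_pullback_def by metis
qed

lemma taut_cat_simps [simp]:
  "Obj (taut_cat U) = {F. taut_functor U F}"
  "Dom (taut_cat U) = NDom" "Cod (taut_cat U) = NCod"
  "Id (taut_cat U) = Id (set_functor_cat U)"
  "Comp (taut_cat U) = Comp (set_functor_cat U)"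
  by (simp_all add: taut_cat_def functor_cat_def)

lemma hom_taut_cat:
  "t \<in> Hom (taut_cat U) F G \<longleftrightarrow>
    taut_functor U F \<and> taut_functor U G \<and> taut_nat_trans U t \<and> NDom t = F \<and> NCod t = G"
  by (auto simp: Hom_def taut_cat_def)

lemma hom_taut_cat_sub: "t \<in> Hom (taut_cat U) F G \<Longrightarrow> t \<in> Hom (set_functor_cat U) F G"
  by (simp add: hom_taut_cat hom_functor_cat taut_nat_trans_def)

section \<open>Adding a point\<close>

lemma infinite_UNIV: "infinite (UNIV :: 'u set)"
  using infinite_member rev_finite_subset[OF _ subset_UNIV] by auto

text \<open>An infinite type has as many pairs as elements. The pairing is used twice: for the
  injectivity of \<open>enc\<close> and for coding a stage together with an element.\<close>

lemma ex_pairing: "\<exists>\<pi> :: 'u \<times> 'u \<Rightarrow> 'u. inj \<pi>"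
proof -
  obtain \<pi> :: "'u \<times> 'u \<Rightarrow> 'u" where "bij_betw \<pi> (UNIV \<times> UNIV) UNIV"
    using card_of_Times_same_infinite[OF infinite_UNIV] unfolding card_of_ordIso[symmetric] by blast
  then show ?thesis
    using bij_betw_imp_inj_on by auto
qed

text \<open>\<open>enc\<close> is a chosen function, so it is injective once some injection exists.
  The pairing provides one by tagging: first coordinate a marks \<open>None\<close>, first
  coordinate b marks the values.\<close>

lemma inj_enc: "inj (enc :: 'u option \<Rightarrow> 'u)"
proof -
  obtain \<pi> :: "'u \<times> 'u \<Rightarrow> 'u" where \<pi>: "inj \<pi>"
    using ex_pairing by blast
  obtain a b :: 'u where "a \<noteq> b"
    using infinite_UNIV by (metis finite.simps finite_subset subsetI singletonI UNIV_I)
  then have "inj (\<lambda>x. case x of None \<Rightarrow> \<pi> (a, a) | Some y \<Rightarrow> \<pi> (b, y))"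
    using \<pi> by (auto intro!: injI simp: inj_eq split: option.splits)
  then show ?thesis
    unfolding enc_def by (rule someI[of inj])
qed

text \<open>A binary union is a union over a two-element index set, which belongs to
  \<open>U\<close> as a subset of an infinite member.\<close>

lemma Un_in:
  assumes "A \<in> U" "B \<in> U"
  shows "A \<union> B \<in> U"
proof -
  obtain N where N: "N \<in> U" "infinite N"
    using infinite_member by blast
  then obtain a b where ab: "a \<in> N" "b \<in> N" "a \<noteq> b"
    by (metis finite.simps finite_subset subsetI singletonI)
  then have "{a, b} \<in> U"
    using subset_closed[OF N(1)] by simp
  then have "(\<Union>x\<in>{a, b}. if x = a then A else B) \<in> U"
    using assms by (intro Union_closed) auto
  then show ?thesis
    using ab by (simp add: Un_commute)
qed

lemma plus1_in: "X \<in> U \<Longrightarrow> plus1 X \<in> U"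
  using Un_in[OF singleton_in image_closed, of X "enc None" "\<lambda>x. enc (Some x)"]
  by (simp add: plus1_def image_image)

lemma plus1_cases:
  assumes "y \<in> plus1 X"
  obtains "y = enc None" | x where "x \<in> X" "y = enc (Some x)"
  using assms by (auto simp: plus1_def)

lemma enc_eq [simp]: "enc x = (enc y :: 'u) \<longleftrightarrow> x = y"
  using inj_enc by (simp add: inj_eq)

lemma enc_in_plus1 [simp]: "enc None \<in> plus1 X" "enc (Some x) \<in> plus1 X \<longleftrightarrow> (x :: 'u) \<in> X"
  by (auto simp: plus1_def)

lemma inj1_hom: "X \<in> U \<Longrightarrow> inj1 X \<in> Hom S X (plus1 X)"
  using plus1_in by (auto simp: inj1_def hom_set_cat)

lemma fn_inj1 [simp]: "x \<in> X \<Longrightarrow> fn (inj1 X) x = enc (Some x)"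
  by (simp add: inj1_def)

lemma inj_inj1: "inj_on (fn (inj1 X)) (X :: 'u set)"
  by (rule inj_onI) simp

lemma src_tgt_plus1_map [simp]:
  "src (plus1_map f) = plus1 (src f)" "tgt (plus1_map f) = plus1 (tgt f)"
  by (simp_all add: plus1_map_def)

lemma fn_plus1_map [simp]:
  fixes f :: "'u set_map"
  shows "fn (plus1_map f) (enc None) = enc None"
    "x \<in> src f \<Longrightarrow> fn (plus1_map f) (enc (Some x)) = enc (Some (fn f x))"
  using inj_enc by (simp_all add: plus1_map_def)

lemma plus1_map_hom:
  assumes "f \<in> Hom S X Y"
  shows "plus1_map f \<in> Hom S (plus1 X) (plus1 Y)"
proof -
  have f: "src f = X" "tgt f = Y" "X \<in> U" "Y \<in> U"
    using assms by (auto simp: hom_set_cat)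
  have "fn (plus1_map f) y \<in> plus1 Y" if "y \<in> plus1 X" for y
    using that by (rule plus1_cases) (use f fn_in[OF assms] in auto)
  moreover have "fn (plus1_map f) \<in> extensional (plus1 X)"
    using f by (simp add: plus1_map_def)
  ultimately show ?thesis
    using f plus1_in by (auto simp: hom_set_cat PiE_iff)
qed

lemma plus1_map_arr: "f \<in> Arr S \<Longrightarrow> plus1_map f \<in> Arr S"
  using plus1_map_hom[of f "src f" "tgt f"] by (simp add: Hom_def)

lemma plus1_map_Id:
  assumes "X \<in> U"
  shows "plus1_map (Id S X) = Id S (plus1 X)"
proof (rule set_map_eqI)
  have "Id S X \<in> Hom S X X"
    using assms category.id_hom[OF category_set_cat] by simp
  then show "plus1_map (Id S X) \<in> Hom S (plus1 X) (plus1 X)"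
    by (rule plus1_map_hom)
  show "Id S (plus1 X) \<in> Hom S (plus1 X) (plus1 X)"
    using plus1_in[OF assms] by (auto simp: hom_set_cat)
  show "fn (plus1_map (Id S X)) y = fn (Id S (plus1 X)) y" if "y \<in> plus1 X" for y
    using that by (rule plus1_cases) auto
qed

lemma plus1_map_Comp:
  assumes f: "f \<in> Hom S X Y" and g: "g \<in> Hom S Y Z"
  shows "plus1_map (Comp S g f) = Comp S (plus1_map g) (plus1_map f)"
proof (rule set_map_eqI)
  have gf: "Comp S g f \<in> Hom S X Z"
    by (rule category.comp_hom[OF category_set_cat f g])
  then show "plus1_map (Comp S g f) \<in> Hom S (plus1 X) (plus1 Z)"
    by (rule plus1_map_hom)
  show "Comp S (plus1_map g) (plus1_map f) \<in> Hom S (plus1 X) (plus1 Z)"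
    by (rule category.comp_hom[OF category_set_cat plus1_map_hom[OF f] plus1_map_hom[OF g]])
  have src: "src f = X" "src g = Y" "src (Comp S g f) = X"
    using f g gf by (auto simp only: hom_set_cat)
  show "fn (plus1_map (Comp S g f)) y = fn (Comp S (plus1_map g) (plus1_map f)) y"
    if y: "y \<in> plus1 X" for y
    using y
  proof (rule plus1_cases)
    fix x assume x: "x \<in> X" "y = enc (Some x)"
    show ?thesis
      using fn_Comp[OF plus1_map_hom[OF f] y] fn_Comp[OF f x(1)] fn_in[OF f x(1)] x src
      by (simp only: fn_plus1_map)
  next
    assume "y = enc None"
    then show ?thesis
      using fn_Comp[OF plus1_map_hom[OF f] y] by (simp only: fn_plus1_map)
  qed
qed

lemma inj_plus1_map:
  fixes f :: "'u set_map"
  assumes "inj_on (fn f) (src f)"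
  shows "inj_on (fn (plus1_map f)) (plus1 (src f))"
  using assms by (intro inj_onI) (auto elim!: plus1_cases dest: inj_onD)

text \<open>Since f + 1 and m + 1 send exactly the added point to the added point, a compatible pair
  consists of two added points or of two old elements. Tautness of a difference functor rests on
  this.\<close>

lemma set_pullback_plus1_map:
  assumes arr: "{p, q, f, m} \<subseteq> Arr S" and m: "inj_on (fn m) (src m)" and pb: "set_pullback p q f m"
  shows "set_pullback (plus1_map p) (plus1_map q) (plus1_map f) (plus1_map m)"
proof (rule set_pullback_monoI)
  have sq: "src p = src q" "tgt p = src f" "tgt q = src m" "tgt f = tgt m"
    and comm: "\<And>u. u \<in> src p \<Longrightarrow> fn f (fn p u) = fn m (fn q u)"
    using pb unfolding set_pullback_def by blast+
  show "src (plus1_map p) = src (plus1_map q)" "tgt (plus1_map p) = src (plus1_map f)"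
    "tgt (plus1_map q) = src (plus1_map m)" "tgt (plus1_map f) = tgt (plus1_map m)"
    using sq by simp_all
  have hom: "p \<in> Hom S (src p) (src f)" "q \<in> Hom S (src p) (src m)"
    using arr sq by (simp_all add: Hom_def)
  show "fn (plus1_map f) (fn (plus1_map p) u) = fn (plus1_map m) (fn (plus1_map q) u)"
    if "u \<in> src (plus1_map p)" for u
  proof -
    have "u \<in> plus1 (src p)"
      using that by simp
    then show ?thesis
    proof (rule plus1_cases)
      fix x assume "x \<in> src p" "u = enc (Some x)"
      then show ?thesis
        using comm sq(1) fn_in[OF hom(1), of x] fn_in[OF hom(2), of x] by simp
    qed simp
  qed
  show "inj_on (fn (plus1_map p)) (src (plus1_map p))"
    using inj_plus1_map set_pullback_inj[OF pb m, of U] arr by simp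
  show "\<exists>u. u \<in> src (plus1_map p) \<and> fn (plus1_map p) u = a \<and> fn (plus1_map q) u = b"
    if a: "a \<in> src (plus1_map f)" and b: "b \<in> src (plus1_map m)"
      and eq: "fn (plus1_map f) a = fn (plus1_map m) b" for a b
  proof -
    have "a \<in> plus1 (src f)" "b \<in> plus1 (src m)"
      using a b by simp_all
    then consider "a = enc None" "b = enc None" | x y where "x \<in> src f" "y \<in> src m"
      "a = enc (Some x)" "b = enc (Some y)" "fn f x = fn m y"
      using eq by (auto elim!: plus1_cases)
    then show ?thesis
    proof cases
      case 1
      then show ?thesis
        by (intro exI[of _ "enc None"]) simp
    next
      case (2 x y)
      then obtain u where "u \<in> src p" "fn p u = x" "fn q u = y"
        using pb unfolding set_pullback_def by metis
      then show ?thesis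
        using 2 sq(1) by (intro exI[of _ "enc (Some u)"]) simp
    qed
  qed
qed

text \<open>The added point goes to the added point, so X is the inverse image of Y along f + 1.
  This square lets the difference functor act on f.\<close>

lemma set_pullback_inj1:
  assumes f: "f \<in> Hom S X Y"
  shows "set_pullback (inj1 X) f (plus1_map f) (inj1 Y)"
proof (rule set_pullback_monoI)
  have XY: "X \<in> U" "Y \<in> U" "src f = X" "tgt f = Y"
    using f by (auto simp: hom_set_cat)
  then show "src (inj1 X) = src f" "tgt (inj1 X) = src (plus1_map f)" "tgt f = src (inj1 Y)"
    "tgt (plus1_map f) = tgt (inj1 Y)"
    by (simp_all add: inj1_def)
  have src: "src (inj1 X) = X" "src (inj1 Y) = Y"
    by (simp_all add: inj1_def)
  show "fn (plus1_map f) (fn (inj1 X) u) = fn (inj1 Y) (fn f u)" if "u \<in> src (inj1 X)" for u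
    using that fn_in[OF f] XY src by simp
  show "inj_on (fn (inj1 X)) (src (inj1 X))"
    using inj_inj1 src by simp
  show "\<exists>u. u \<in> src (inj1 X) \<and> fn (inj1 X) u = a \<and> fn f u = b"
    if "a \<in> src (plus1_map f)" "b \<in> src (inj1 Y)" "fn (plus1_map f) a = fn (inj1 Y) b" for a b
  proof -
    have "a \<in> plus1 X" "b \<in> Y"
      using that XY src by simp_all
    then show ?thesis
      using that(3) XY src by (auto elim!: plus1_cases)
  qed
qed

end

section \<open>The difference functor\<close>

lemma is_functor_comp:
  assumes "category C" and F: "is_functor C D F" and G: "is_functor D E G"
  shows "is_functor C E (comp_functor C G F)"
proof -
  interpret category C by fact
  have Farr: "\<And>X Y f. f \<in> Hom C X Y \<Longrightarrow> AMap F f \<in> Hom D (OMap F X) (OMap F Y)"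
    and Fid: "\<And>X. X \<in> Obj C \<Longrightarrow> AMap F (Id C X) = Id D (OMap F X)"
    and Fcomp: "\<And>X Y Z f g. f \<in> Hom C X Y \<Longrightarrow> g \<in> Hom C Y Z \<Longrightarrow>
      AMap F (Comp C g f) = Comp D (AMap F g) (AMap F f)"
    and Fmaps: "OMap F \<in> Obj C \<rightarrow>\<^sub>E Obj D" "AMap F \<in> Arr C \<rightarrow>\<^sub>E Arr D"
    using F unfolding is_functor_def by blast+
  have Garr: "\<And>X Y f. f \<in> Hom D X Y \<Longrightarrow> AMap G f \<in> Hom E (OMap G X) (OMap G Y)"
    and Gid: "\<And>X. X \<in> Obj D \<Longrightarrow> AMap G (Id D X) = Id E (OMap G X)"
    and Gcomp: "\<And>X Y Z f g. f \<in> Hom D X Y \<Longrightarrow> g \<in> Hom D Y Z \<Longrightarrow>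
      AMap G (Comp D g f) = Comp E (AMap G g) (AMap G f)"
    and Gmaps: "OMap G \<in> Obj D \<rightarrow>\<^sub>E Obj E" "AMap G \<in> Arr D \<rightarrow>\<^sub>E Arr E"
    using G unfolding is_functor_def by blast+
  have obj: "OMap F X \<in> Obj D" if "X \<in> Obj C" for X
    using Fmaps(1) that by (rule PiE_mem)
  have hom_ends: "f \<in> Arr C" "X \<in> Obj C" "Y \<in> Obj C" if "f \<in> Hom C X Y" for f X Y
    using that dom_obj cod_obj by (auto simp: Hom_def)
  let ?H = "comp_functor C G F"
  have OH: "OMap ?H X = OMap G (OMap F X)" if "X \<in> Obj C" for X
    using that by (simp add: comp_functor_def)
  have AH: "AMap ?H f = AMap G (AMap F f)" if "f \<in> Arr C" for f
    using that by (simp add: comp_functor_def)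
  show ?thesis
    unfolding is_functor_def
  proof (intro conjI allI ballI)
    show "OMap ?H \<in> Obj C \<rightarrow>\<^sub>E Obj E" "AMap ?H \<in> Arr C \<rightarrow>\<^sub>E Arr E"
      using Fmaps Gmaps by (auto simp: comp_functor_def)
    show "AMap ?H f \<in> Hom E (OMap ?H X) (OMap ?H Y)" if f: "f \<in> Hom C X Y" for X Y f
      using Garr[OF Farr[OF f]] AH[OF hom_ends(1)[OF f]] OH hom_ends(2,3)[OF f] by simp
    show "AMap ?H (Id C X) = Id E (OMap ?H X)" if X: "X \<in> Obj C" for X
      using AH[OF hom_ends(1)[OF id_hom[OF X]]] OH[OF X] Fid[OF X] Gid[OF obj[OF X]] by simp
    show "AMap ?H (Comp C g f) = Comp E (AMap ?H g) (AMap ?H f)"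
      if f: "f \<in> Hom C X Y" and g: "g \<in> Hom C Y Z" for X Y Z f g
      using AH[OF hom_ends(1)[OF comp_hom[OF f g]]] AH[OF hom_ends(1)[OF f]] AH[OF hom_ends(1)[OF g]]
        Fcomp[OF f g] Gcomp[OF Farr[OF f] Farr[OF g]] by simp
  qed
qed

context set_universe
begin

lemma diff_set_iff:
  "x \<in> diff_set F X \<longleftrightarrow>
    x \<in> OMap F (plus1 X) \<and> (\<forall>y\<in>OMap F X. ap F (inj1 X) y \<noteq> x)"
  by (auto simp: diff_set_def)

lemma diff_obj_eq: "diff_obj U F = mk_functor U (diff_set F) (\<lambda>f. ap F (plus1_map f))"
  by (simp add: diff_obj_def mk_functor_def)

lemma OMap_diff_obj [simp]: "X \<in> U \<Longrightarrow> OMap (diff_obj U F) X = diff_set F X"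
  by (simp add: diff_obj_def)

lemma ap_diff_obj [simp]:
  assumes "f \<in> Hom S X Y" "x \<in> diff_set F X"
  shows "ap (diff_obj U F) f x = ap F (plus1_map f) x"
  using arr_of_hom[OF assms(1)] assms(2) by (simp add: diff_obj_def)

lemma diff_set_natural:
  assumes F: "is_functor S S F" and f: "f \<in> Hom S X Y" and y: "y \<in> OMap F X"
  shows "ap F (plus1_map f) (ap F (inj1 X) y) = ap F (inj1 Y) (ap F f y)"
proof (rule ap_commute[OF F _ plus1_map_hom[OF f] f _ _ y])
  have "X \<in> U" "Y \<in> U" "src f = X"
    using f by (auto simp: hom_set_cat)
  then show "inj1 X \<in> Hom S X (plus1 X)" "inj1 Y \<in> Hom S Y (plus1 Y)"
    "\<And>x. x \<in> X \<Longrightarrow> fn (plus1_map f) (fn (inj1 X) x) = fn (inj1 Y) (fn f x)"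
    using inj1_hom fn_in[OF f] by auto
qed

text \<open>If the image of x came from F Y, the pullback square of
  \<open>set_pullback_inj1\<close>, preserved by F, would make x come from F X.\<close>

lemma ap_plus1_diff:
  assumes F: "taut_functor U F" and f: "f \<in> Hom S X Y" and x: "x \<in> diff_set F X"
  shows "ap F (plus1_map f) x \<in> diff_set F Y"
  unfolding diff_set_iff
proof (intro conjI ballI notI)
  note Ff = taut_functor_is_functor[OF F]
  have x': "x \<in> OMap F (plus1 X)" and nx: "\<And>y. y \<in> OMap F X \<Longrightarrow> ap F (inj1 X) y \<noteq> x"
    using x by (auto simp: diff_set_iff)
  show "ap F (plus1_map f) x \<in> OMap F (plus1 Y)"
    by (rule ap_in[OF Ff plus1_map_hom[OF f] x'])
  fix y assume y: "y \<in> OMap F Y" and eq: "ap F (inj1 Y) y = ap F (plus1_map f) x"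
  have XY: "X \<in> U" "Y \<in> U" "f \<in> Arr S" "src f = X"
    using f by (auto simp: hom_set_cat arr_set_cat)
  have "{inj1 X, f, plus1_map f, inj1 Y} \<subseteq> Arr S"
    using arr_of_hom[OF inj1_hom] XY plus1_map_arr by auto
  moreover have ends: "src (inj1 X) = X" "src (inj1 Y) = Y" "src (plus1_map f) = plus1 X"
    using XY by (simp_all add: inj1_def)
  ultimately have "\<exists>!u. u \<in> OMap F (src (inj1 X)) \<and> ap F (inj1 X) u = x \<and> ap F f u = y"
    using inj_inj1 x' y eq by (intro taut_functor_pb[OF F _ _ set_pullback_inj1[OF f]]) simp_all
  then show False
    using nx ends by auto
qed

lemma is_functor_diff_obj:
  assumes F: "taut_functor U F"
  shows "is_functor S S (diff_obj U F)"
  unfolding diff_obj_eq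
proof (rule is_functor_mk)
  note Ff = taut_functor_is_functor[OF F]
  show "diff_set F X \<in> U" if "X \<in> U" for X
    using is_functorD(1)[OF Ff plus1_in[OF that]] by (rule subset_closed) (auto simp: diff_set_def)
  show "ap F (plus1_map f) x \<in> diff_set F Y" if "f \<in> Hom S X Y" "x \<in> diff_set F X" for f X Y x
    by (rule ap_plus1_diff[OF F that])
  show "ap F (plus1_map (Id S X)) x = x" if "X \<in> U" "x \<in> diff_set F X" for X x
    using that ap_id[OF Ff plus1_in] plus1_map_Id by (simp only: diff_set_iff)
  show "ap F (plus1_map (Comp S g f)) x = ap F (plus1_map g) (ap F (plus1_map f) x)"
    if f: "f \<in> Hom S X Y" and g: "g \<in> Hom S Y Z" and x: "x \<in> diff_set F X" for X Y Z f g x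
    using ap_comp[OF Ff plus1_map_hom[OF f] plus1_map_hom[OF g]] x
    by (simp only: plus1_map_Comp[OF f g] diff_set_iff)
qed

text \<open>F preserves the square obtained by adding a point to every corner, which supplies the
  lift; what remains is that the lift stays in the difference set.\<close>

lemma taut_functor_diff_obj:
  assumes F: "taut_functor U F"
  shows "taut_functor U (diff_obj U F)"
proof (rule taut_functorI[OF is_functor_diff_obj[OF F]])
  note Ff = taut_functor_is_functor[OF F]
  show "inj_on (ap (diff_obj U F) m) (OMap (diff_obj U F) (src m))"
    if m: "m \<in> Arr S" "inj_on (fn m) (src m)" for m
  proof -
    have "m \<in> Hom S (src m) (tgt m)" "src m \<in> U"
      using m(1) by (simp_all add: Hom_def arr_set_cat)
    then show ?thesis
      using taut_functor_inj[OF F plus1_map_arr[OF m(1)]] inj_plus1_map[OF m(2)]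
      by (auto simp: inj_on_def diff_set_iff)
  qed
  fix p q f m a b
  assume arr: "{p, q, f, m} \<subseteq> Arr S" and m: "inj_on (fn m) (src m)" and pb: "set_pullback p q f m"
    and a: "a \<in> OMap (diff_obj U F) (src f)" and b: "b \<in> OMap (diff_obj U F) (src m)"
    and eq: "ap (diff_obj U F) f a = ap (diff_obj U F) m b"
  have sq: "src p = src q" "tgt p = src f" "tgt q = src m" "tgt f = tgt m"
    using pb unfolding set_pullback_def by blast+
  have hom: "p \<in> Hom S (src p) (src f)" "q \<in> Hom S (src p) (src m)"
    "f \<in> Hom S (src f) (tgt f)" "m \<in> Hom S (src m) (tgt m)"
    and U: "src p \<in> U" "src f \<in> U" "src m \<in> U"
    using arr sq by (auto simp: Hom_def arr_set_cat)
  have a': "a \<in> diff_set F (src f)" and b': "b \<in> diff_set F (src m)"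
    using a b U by simp_all
  have "{plus1_map p, plus1_map q, plus1_map f, plus1_map m} \<subseteq> Arr S"
    using arr plus1_map_arr by simp
  then have "\<exists>!u. u \<in> OMap F (src (plus1_map p)) \<and>
      ap F (plus1_map p) u = a \<and> ap F (plus1_map q) u = b"
    using inj_plus1_map[OF m] set_pullback_plus1_map[OF arr m pb] a' b' eq ap_diff_obj[OF hom(3) a']
      ap_diff_obj[OF hom(4) b']
    by (intro taut_functor_pb[OF F]) (simp_all add: diff_set_iff)
  then obtain u where u: "u \<in> OMap F (plus1 (src p))"
    "ap F (plus1_map p) u = a" "ap F (plus1_map q) u = b"
    by auto
  \<comment> \<open>If u came from F of the corner without the point, naturality of the coproduct
    injection would make a come from F of \<open>src f\<close>.\<close>
  have "u \<in> diff_set F (src p)"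
    unfolding diff_set_iff
  proof (intro conjI ballI notI u)
    fix v assume v: "v \<in> OMap F (src p)" "ap F (inj1 (src p)) v = u"
    have "a = ap F (inj1 (src f)) (ap F p v)"
      using diff_set_natural[OF Ff hom(1) v(1)] v(2) u(2) by simp
    then show False
      using a' ap_in[OF Ff hom(1) v(1)] by (auto simp: diff_set_iff)
  qed
  then show "\<exists>u. u \<in> OMap (diff_obj U F) (src p) \<and> ap (diff_obj U F) p u = a \<and>
      ap (diff_obj U F) q u = b"
    using u ap_diff_obj[OF hom(1)] ap_diff_obj[OF hom(2)] U by (intro exI[of _ u]) simp
qed

lemma diff_arr_eq:
  "diff_arr U t =
    mk_nat_trans U (diff_obj U (NDom t)) (diff_obj U (NCod t)) (\<lambda>X. cm t (plus1 X))"
  by (simp add: diff_arr_def mk_nat_trans_def cong: restrict_cong)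

lemma diff_arr_simps [simp]:
  "NDom (diff_arr U t) = diff_obj U (NDom t)" "NCod (diff_arr U t) = diff_obj U (NCod t)"
  "X \<in> U \<Longrightarrow> x \<in> diff_set (NDom t) X \<Longrightarrow> cm (diff_arr U t) X x = cm t (plus1 X) x"
  by (simp_all add: diff_arr_def)

text \<open>Naturality at the injection of X into X + 1 gives the direction from left to right, by
  which preimages of difference elements are difference elements. Tautness there gives the other
  direction, by which t restricts to difference sets.\<close>

lemma cm_plus1_diff_iff:
  assumes t: "taut_nat_trans U t" and X: "X \<in> U" and x: "x \<in> OMap (NDom t) (plus1 X)"
  shows "cm t (plus1 X) x \<in> diff_set (NCod t) X \<longleftrightarrow> x \<in> diff_set (NDom t) X"
proof -
  have nt: "is_nat_trans S S t"
    using t by (simp add: taut_nat_trans_def)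
  have "(\<exists>z\<in>OMap (NCod t) X. ap (NCod t) (inj1 X) z = cm t (plus1 X) x) \<longleftrightarrow>
      (\<exists>y\<in>OMap (NDom t) X. ap (NDom t) (inj1 X) y = x)"
  proof
    assume "\<exists>z\<in>OMap (NCod t) X. ap (NCod t) (inj1 X) z = cm t (plus1 X) x"
    then show "\<exists>y\<in>OMap (NDom t) X. ap (NDom t) (inj1 X) y = x"
      using taut_nat_transD[OF t inj1_hom[OF X] inj_inj1 x] by metis
  next
    assume "\<exists>y\<in>OMap (NDom t) X. ap (NDom t) (inj1 X) y = x"
    then show "\<exists>z\<in>OMap (NCod t) X. ap (NCod t) (inj1 X) z = cm t (plus1 X) x"
      using cm_natural[OF nt inj1_hom[OF X]] cm_in[OF nt X] by metis
  qed
  then show ?thesis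
    using x cm_in[OF nt plus1_in[OF X] x] by (auto simp: diff_set_iff)
qed

text \<open>The lift is taken in the pullback square of t at m + 1; it belongs to the difference set
  because its image z does.\<close>

lemma taut_diff_arr:
  assumes t: "taut_nat_trans U t" and F: "taut_functor U (NDom t)" and G: "taut_functor U (NCod t)"
  shows "taut_nat_trans U (diff_arr U t)"
proof (rule taut_nat_transI)
  have nt: "is_nat_trans S S t"
    using t by (simp add: taut_nat_trans_def)
  note Ff = taut_functor_is_functor[OF F] and Gf = taut_functor_is_functor[OF G]
  show "is_nat_trans S S (diff_arr U t)"
    unfolding diff_arr_eq
  proof (rule is_nat_trans_mk[OF is_functor_diff_obj[OF F] is_functor_diff_obj[OF G]])
    show "cm t (plus1 X) x \<in> OMap (diff_obj U (NCod t)) X"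
      if "X \<in> U" "x \<in> OMap (diff_obj U (NDom t)) X" for X x
      using that cm_plus1_diff_iff[OF t] by (simp add: diff_set_iff)
    show "cm t (plus1 Y) (ap (diff_obj U (NDom t)) f x) = ap (diff_obj U (NCod t)) f (cm t (plus1 X) x)"
      if f: "f \<in> Hom S X Y" and x: "x \<in> OMap (diff_obj U (NDom t)) X" for X Y f x
    proof -
      have "X \<in> U"
        using f by (simp add: hom_set_cat)
      then have x: "x \<in> diff_set (NDom t) X" "x \<in> OMap (NDom t) (plus1 X)"
        using x by (auto simp: diff_set_iff)
      then have "cm t (plus1 X) x \<in> diff_set (NCod t) X"
        using cm_plus1_diff_iff[OF t \<open>X \<in> U\<close>] by blast
      then show ?thesis
        using cm_natural[OF nt plus1_map_hom[OF f] x(2)] f x by simp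
    qed
  qed
  show "taut_functor U (NDom (diff_arr U t))"
    using taut_functor_diff_obj[OF F] by simp
  fix A B m y z
  assume m: "m \<in> Hom S A B" "inj_on (fn m) A"
    and y: "y \<in> OMap (NDom (diff_arr U t)) B" and z: "z \<in> OMap (NCod (diff_arr U t)) A"
    and eq: "cm (diff_arr U t) B y = ap (NCod (diff_arr U t)) m z"
  have AB: "A \<in> U" "B \<in> U" "src m = A"
    using m by (auto simp: hom_set_cat)
  then have y: "y \<in> diff_set (NDom t) B" and z: "z \<in> diff_set (NCod t) A"
    using y z by simp_all
  have "\<exists>u. u \<in> OMap (NDom t) (plus1 A) \<and> ap (NDom t) (plus1_map m) u = y \<and> cm t (plus1 A) u = z"
  proof (rule taut_nat_transD[OF t plus1_map_hom[OF m(1)]])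
    show "inj_on (fn (plus1_map m)) (plus1 A)"
      using inj_plus1_map[of m] m AB by simp
    show "cm t (plus1 B) y = ap (NCod t) (plus1_map m) z"
      using eq y z m AB by simp
  qed (use y z in \<open>auto simp: diff_set_iff\<close>)
  then obtain u where u: "u \<in> OMap (NDom t) (plus1 A)"
    "ap (NDom t) (plus1_map m) u = y" "cm t (plus1 A) u = z"
    by blast
  then have "u \<in> diff_set (NDom t) A"
    using cm_plus1_diff_iff[OF t AB(1) u(1)] z by simp
  then show "\<exists>u. u \<in> OMap (NDom (diff_arr U t)) A \<and> ap (NDom (diff_arr U t)) m u = y \<and>
      cm (diff_arr U t) A u = z"
    using u m AB by (intro exI[of _ u]) simp
qed

section \<open>Identities, composites and isomorphisms in Taut; functoriality of \<Delta>\<close>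

text \<open>The inverse s supplies the lift of z, namely the image of z under its component at A.
  Thus an isomorphism found among all functors can be read in Taut.\<close>

lemma taut_nat_trans_iso:
  assumes t: "t \<in> Hom (set_functor_cat U) F G" and s: "s \<in> Hom (set_functor_cat U) G F"
    and st: "Comp (set_functor_cat U) s t = Id (set_functor_cat U) F"
    and ts: "Comp (set_functor_cat U) t s = Id (set_functor_cat U) G"
    and F: "taut_functor U F"
  shows "taut_nat_trans U t"
proof (rule taut_nat_transI)
  have nt: "is_nat_trans S S t" "is_nat_trans S S s"
    and ends: "NDom t = F" "NCod t = G" "NDom s = G" "NCod s = F"
    using s t by (simp_all add: hom_functor_cat)
  show "is_nat_trans S S t" "taut_functor U (NDom t)"
    using nt F ends by simp_all
  fix A B m y z
  assume m: "m \<in> Hom S A B" and y: "y \<in> OMap (NDom t) B" and z: "z \<in> OMap (NCod t) A"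
    and eq: "cm t B y = ap (NCod t) m z"
  have AB: "A \<in> U" "B \<in> U"
    using m by (auto simp: hom_set_cat)
  have "ap F m (cm s A z) = cm s B (ap G m z)"
    using cm_natural[OF nt(2) m, of z] z ends by simp
  also have "\<dots> = cm s B (cm t B y)"
    using eq ends by simp
  also have "\<dots> = y"
    using cm_Comp[OF nt(1) AB(2) y, of s] cm_Id[OF AB(2), of y F] y st ends by metis
  finally have "ap F m (cm s A z) = y" .
  moreover have "cm t A (cm s A z) = z"
    using cm_Comp[OF nt(2) AB(1), of z t] cm_Id[OF AB(1), of z G] z ts ends by metis
  ultimately show "\<exists>u. u \<in> OMap (NDom t) A \<and> ap (NDom t) m u = y \<and> cm t A u = z"
    using cm_in[OF nt(2) AB(1), of z] z ends by auto
qed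

text \<open>An identity is its own inverse, so \<open>taut_nat_trans_iso\<close> applies.\<close>

lemma taut_nat_trans_Id: "taut_functor U F \<Longrightarrow> taut_nat_trans U (Id (set_functor_cat U) F)"
proof -
  interpret category "set_functor_cat U"
    by (rule category_set_functor_cat)
  assume F: "taut_functor U F"
  then have i: "Id (set_functor_cat U) F \<in> Hom (set_functor_cat U) F F"
    using id_hom taut_functor_is_functor by simp
  show ?thesis
    by (rule taut_nat_trans_iso[OF i i comp_id_left[OF i] comp_id_left[OF i] F])
qed

text \<open>Pasting of pullback squares: the element is lifted through s and the result is lifted
  through t.\<close>

lemma taut_nat_trans_Comp:
  assumes s: "taut_nat_trans U s" and t: "taut_nat_trans U t" and st: "NDom s = NCod t"
    and F: "taut_functor U (NDom t)"
  shows "taut_nat_trans U (Comp (set_functor_cat U) s t)"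
proof (rule taut_nat_transI)
  have nt: "is_nat_trans S S s" "is_nat_trans S S t"
    using s t by (simp_all add: taut_nat_trans_def)
  show "is_nat_trans S S (Comp (set_functor_cat U) s t)"
    using nt st by (rule is_nat_trans_Comp)
  show "taut_functor U (NDom (Comp (set_functor_cat U) s t))"
    using F by simp
  fix A B m y z
  assume m: "m \<in> Hom S A B" "inj_on (fn m) A"
    and y: "y \<in> OMap (NDom (Comp (set_functor_cat U) s t)) B"
    and z: "z \<in> OMap (NCod (Comp (set_functor_cat U) s t)) A"
    and eq: "cm (Comp (set_functor_cat U) s t) B y = ap (NCod (Comp (set_functor_cat U) s t)) m z"
  have AB: "A \<in> U" "B \<in> U"
    using m by (auto simp: hom_set_cat)
  have y: "y \<in> OMap (NDom t) B" and z: "z \<in> OMap (NCod s) A"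
    using y z by simp_all
  have "cm s B (cm t B y) = ap (NCod s) m z"
    using eq cm_Comp[OF nt(2) AB(2) y] by simp
  moreover have "cm t B y \<in> OMap (NDom s) B"
    using cm_in[OF nt(2) AB(2) y] st by simp
  ultimately obtain w where w: "w \<in> OMap (NCod t) A" "ap (NCod t) m w = cm t B y" "cm s A w = z"
    using taut_nat_transD[OF s m] z st by metis
  obtain u where "u \<in> OMap (NDom t) A" "ap (NDom t) m u = y" "cm t A u = w"
    using taut_nat_transD[OF t m y w(1)] w(2) by metis
  then show "\<exists>u. u \<in> OMap (NDom (Comp (set_functor_cat U) s t)) A \<and>
      ap (NDom (Comp (set_functor_cat U) s t)) m u = y \<and> cm (Comp (set_functor_cat U) s t) A u = z"
    using w(3) cm_Comp[OF nt(2) AB(1)] by (intro exI[of _ u]) simp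
qed

text \<open>Makes the composite of \<Delta> with a diagram of taut functors again such a diagram, to
  which the results on confluent colimits apply.\<close>

lemma is_functor_Delta: "is_functor (taut_cat U) (taut_cat U) (Delta U)"
proof -
  have arr_Delta: "AMap (Delta U) t = diff_arr U t" if "t \<in> Hom (taut_cat U) F G" for t F G
    using that by (simp add: Delta_def Hom_def)
  have obj_Delta: "OMap (Delta U) F = diff_obj U F" if "taut_functor U F" for F
    using that by (simp add: Delta_def)
  have hom_diff: "diff_arr U t \<in> Hom (taut_cat U) (diff_obj U F) (diff_obj U G)"
    if "t \<in> Hom (taut_cat U) F G" for t F G
    using that taut_functor_diff_obj taut_diff_arr[of t] by (auto simp: hom_taut_cat)
  have Id: "Id (taut_cat U) F \<in> Hom (taut_cat U) F F" if "taut_functor U F" for F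
    using that taut_nat_trans_Id by (simp add: hom_taut_cat)
  have Comp: "Comp (taut_cat U) s t \<in> Hom (taut_cat U) F H"
    if "t \<in> Hom (taut_cat U) F G" "s \<in> Hom (taut_cat U) G H" for s t F G H
    using that taut_nat_trans_Comp[of s t] by (auto simp: hom_taut_cat)
  note nat = hom_taut_cat_sub[unfolded hom_functor_cat]
  show ?thesis
    unfolding is_functor_def
  proof (intro conjI allI ballI)
    show "OMap (Delta U) \<in> Obj (taut_cat U) \<rightarrow>\<^sub>E Obj (taut_cat U)"
      using taut_functor_diff_obj by (simp add: Delta_def)
    have "diff_arr U t \<in> Arr (taut_cat U)" if "t \<in> Arr (taut_cat U)" for t
      using hom_diff[of t "NDom t" "NCod t"] that by (simp add: Hom_def)
    then show "AMap (Delta U) \<in> Arr (taut_cat U) \<rightarrow>\<^sub>E Arr (taut_cat U)"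
      by (simp add: Delta_def)
    show "AMap (Delta U) t \<in> Hom (taut_cat U) (OMap (Delta U) F) (OMap (Delta U) G)"
      if t: "t \<in> Hom (taut_cat U) F G" for F G t
      using hom_diff[OF t] t by (simp add: arr_Delta[OF t] obj_Delta hom_taut_cat)
    show "AMap (Delta U) (Id (taut_cat U) F) = Id (taut_cat U) (OMap (Delta U) F)"
      if "F \<in> Obj (taut_cat U)" for F
    proof -
      have F: "taut_functor U F" "taut_functor U (diff_obj U F)"
        using that taut_functor_diff_obj by simp_all
      have "diff_arr U (Id (taut_cat U) F) = Id (taut_cat U) (diff_obj U F)"
      proof (rule nat_trans_eqI)
        show "is_nat_trans S S (diff_arr U (Id (taut_cat U) F))"
          using nat[OF hom_diff[OF Id[OF F(1)]]] by blast
        show "is_nat_trans S S (Id (taut_cat U) (diff_obj U F))"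
          using nat[OF Id[OF F(2)]] by blast
        fix X x assume X: "X \<in> U" and "x \<in> OMap (NDom (diff_arr U (Id (taut_cat U) F))) X"
        then have x: "x \<in> diff_set F X" "x \<in> OMap F (plus1 X)"
          by (auto simp: diff_set_iff)
        then show "cm (diff_arr U (Id (taut_cat U) F)) X x = cm (Id (taut_cat U) (diff_obj U F)) X x"
          using X cm_Id[OF plus1_in[OF X] x(2)] cm_Id[OF X, of x "diff_obj U F"] by simp
      qed simp_all
      then show ?thesis
        using arr_Delta[OF Id[OF F(1)]] obj_Delta[OF F(1)] by simp
    qed
    show "AMap (Delta U) (Comp (taut_cat U) s t) =
        Comp (taut_cat U) (AMap (Delta U) s) (AMap (Delta U) t)"
      if t: "t \<in> Hom (taut_cat U) F G" and s: "s \<in> Hom (taut_cat U) G H" for F G H t s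
      unfolding arr_Delta[OF t] arr_Delta[OF s] arr_Delta[OF Comp[OF t s]]
    proof (rule nat_trans_eqI)
      show "is_nat_trans S S (diff_arr U (Comp (taut_cat U) s t))"
        using nat[OF hom_diff[OF Comp[OF t s]]] by blast
      show "is_nat_trans S S (Comp (taut_cat U) (diff_arr U s) (diff_arr U t))"
        using nat[OF Comp[OF hom_diff[OF t] hom_diff[OF s]]] by blast
      have ends: "NDom t = F" "NCod t = G" "NDom s = G" and t': "taut_nat_trans U t" "is_nat_trans S S t"
        "is_nat_trans S S (diff_arr U t)"
        using t s nat[OF t] nat[OF hom_diff[OF t]] by (simp_all add: hom_taut_cat)
      fix X x assume X: "X \<in> U" and "x \<in> OMap (NDom (diff_arr U (Comp (taut_cat U) s t))) X"
      then have x: "x \<in> diff_set (NDom t) X" "x \<in> OMap (NDom t) (plus1 X)"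
        by (auto simp: diff_set_iff)
      \<comment> \<open>The component of \<open>diff_arr U s\<close> agrees with that of s only on
        the difference set, so the image of x must lie there.\<close>
      have "cm t (plus1 X) x \<in> diff_set (NCod t) X"
        using cm_plus1_diff_iff[OF t'(1) X x(2)] x(1) by blast
      then show "cm (diff_arr U (Comp (taut_cat U) s t)) X x =
          cm (Comp (taut_cat U) (diff_arr U s) (diff_arr U t)) X x"
        using cm_Comp[OF t'(3) X, of x "diff_arr U s"] cm_Comp[OF t'(2) plus1_in[OF X] x(2), of s] x X ends
        by simp
    qed simp_all
  qed
qed

end

section \<open>Confluent colimits of taut functors\<close>

text \<open>The locale is interpreted for \<Gamma> and again for its composite with \<Delta>.
  Smallness of \<open>Obj I\<close> bounds the union in which the colimit sets are found.\<close>

locale taut_diagram = set_universe U + I: category I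
  for U :: "'u set set" and I :: "('i, 'b) cat" +
  fixes \<Gamma> :: "('i, 'b, 'u set_functor, 'u set_nat_trans) func"
  assumes confluent: "confluent I"
    and small: "small_set U (Obj I)"
    and functor_diagram: "is_functor I (taut_cat U) \<Gamma>"
begin

abbreviation El :: "'i \<Rightarrow> 'u set \<Rightarrow> 'u set" where
  "El i X \<equiv> OMap (OMap \<Gamma> i) X"

abbreviation tr :: "'b \<Rightarrow> 'u set \<Rightarrow> 'u \<Rightarrow> 'u" where
  "tr f X \<equiv> cm (AMap \<Gamma> f) X"

text \<open>A single cospan takes the place of the usual zigzag of arrows; confluence makes this
  relation transitive already.\<close>

definition merge :: "'u set \<Rightarrow> 'i \<Rightarrow> 'u \<Rightarrow> 'i \<Rightarrow> 'u \<Rightarrow> bool" where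
  "merge X i x j y \<longleftrightarrow> (\<exists>k. \<exists>f\<in>Hom I i k. \<exists>g\<in>Hom I j k. tr f X x = tr g X y)"

text \<open>Each L X is the quotient of the disjoint union of the sets \<open>El i X\<close> by
  \<open>merge\<close>. That merged elements have equal images holds for every cocone, by
  \<open>cocone_merge\<close>.\<close>

definition pointwise_colimit :: "'u set_functor \<Rightarrow> ('i \<Rightarrow> 'u set_nat_trans) \<Rightarrow> bool" where
  "pointwise_colimit L l \<longleftrightarrow> is_cocone I (set_functor_cat U) \<Gamma> L l \<and>
    (\<forall>X\<in>U. \<forall>z\<in>OMap L X. \<exists>i\<in>Obj I. \<exists>x\<in>El i X. z = cm (l i) X x) \<and>
    (\<forall>X\<in>U. \<forall>i\<in>Obj I. \<forall>j\<in>Obj I. \<forall>x\<in>El i X. \<forall>y\<in>El j X.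
      cm (l i) X x = cm (l j) X y \<longrightarrow> merge X i x j y)"

section \<open>Transition maps and cocones on elements\<close>

lemma hom_obj: "f \<in> Hom I i j \<Longrightarrow> i \<in> Obj I \<and> j \<in> Obj I"
  using I.dom_obj I.cod_obj by (auto simp: Hom_def)

lemma taut_obj: "i \<in> Obj I \<Longrightarrow> taut_functor U (OMap \<Gamma> i)"
  using functor_diagram PiE_mem[of "OMap \<Gamma>" "Obj I" "\<lambda>_. Obj (taut_cat U)" i]
  unfolding is_functor_def by simp

lemma functor_obj: "i \<in> Obj I \<Longrightarrow> is_functor S S (OMap \<Gamma> i)"
  by (rule taut_functor_is_functor[OF taut_obj])

lemma arr_hom_taut: "f \<in> Hom I i j \<Longrightarrow> AMap \<Gamma> f \<in> Hom (taut_cat U) (OMap \<Gamma> i) (OMap \<Gamma> j)"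
  using functor_diagram unfolding is_functor_def by blast

lemma arr_nat:
  assumes "f \<in> Hom I i j"
  shows "is_nat_trans S S (AMap \<Gamma> f)" "taut_nat_trans U (AMap \<Gamma> f)"
    "NDom (AMap \<Gamma> f) = OMap \<Gamma> i" "NCod (AMap \<Gamma> f) = OMap \<Gamma> j"
  using arr_hom_taut[OF assms] hom_taut_cat_sub[OF arr_hom_taut[OF assms]]
  by (simp_all add: hom_taut_cat hom_functor_cat)

lemma tr_in:
  assumes "f \<in> Hom I i j" "X \<in> U" "x \<in> El i X"
  shows "tr f X x \<in> El j X"
  using cm_in[OF arr_nat(1)[OF assms(1)] assms(2)] assms(3) arr_nat(3,4)[OF assms(1)] by simp

lemma tr_natural:
  assumes "f \<in> Hom I i j" "h \<in> Hom S X Y" "x \<in> El i X"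
  shows "tr f Y (ap (OMap \<Gamma> i) h x) = ap (OMap \<Gamma> j) h (tr f X x)"
  using cm_natural[OF arr_nat(1)[OF assms(1)] assms(2)] assms(3) arr_nat(3,4)[OF assms(1)] by simp

lemma tr_Id:
  assumes "i \<in> Obj I" "X \<in> U" "x \<in> El i X"
  shows "tr (Id I i) X x = x"
proof -
  have "AMap \<Gamma> (Id I i) = Id (taut_cat U) (OMap \<Gamma> i)"
    using functor_diagram assms(1) unfolding is_functor_def by blast
  then show ?thesis
    using cm_Id[OF assms(2,3)] by simp
qed

lemma tr_Comp:
  assumes f: "f \<in> Hom I i j" and g: "g \<in> Hom I j k" and X: "X \<in> U" "x \<in> El i X"
  shows "tr (Comp I g f) X x = tr g X (tr f X x)"
proof -
  have "AMap \<Gamma> (Comp I g f) = Comp (taut_cat U) (AMap \<Gamma> g) (AMap \<Gamma> f)"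
    using functor_diagram f g unfolding is_functor_def by blast
  then show ?thesis
    using cm_Comp[OF arr_nat(1)[OF f] X(1), of x] X(2) arr_nat(3)[OF f] by simp
qed

lemma cocone_leg:
  assumes "is_cocone I (set_functor_cat U) \<Gamma> L l" "i \<in> Obj I"
  shows "is_nat_trans S S (l i)" "NDom (l i) = OMap \<Gamma> i" "NCod (l i) = L"
  using assms by (auto simp: is_cocone_def hom_functor_cat)

lemma cocone_in:
  assumes "is_cocone I (set_functor_cat U) \<Gamma> L l" "i \<in> Obj I" "X \<in> U" "x \<in> El i X"
  shows "cm (l i) X x \<in> OMap L X"
  using cm_in[OF cocone_leg(1)[OF assms(1,2)] assms(3)] assms(4) cocone_leg(2,3)[OF assms(1,2)] by simp

lemma cocone_natural:
  assumes "is_cocone I (set_functor_cat U) \<Gamma> L l" "i \<in> Obj I" "h \<in> Hom S X Y" "x \<in> El i X"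
  shows "cm (l i) Y (ap (OMap \<Gamma> i) h x) = ap L h (cm (l i) X x)"
  using cm_natural[OF cocone_leg(1)[OF assms(1,2)] assms(3)] assms(4) cocone_leg(2,3)[OF assms(1,2)]
  by simp

lemma cocone_tr:
  assumes "is_cocone I (set_functor_cat U) \<Gamma> L l" "f \<in> Hom I i j" "X \<in> U" "x \<in> El i X"
  shows "cm (l j) X (tr f X x) = cm (l i) X x"
proof -
  have "Comp (set_functor_cat U) (l j) (AMap \<Gamma> f) = l i"
    using assms(1,2) unfolding is_cocone_def by blast
  then show ?thesis
    using cm_Comp[OF arr_nat(1)[OF assms(2)] assms(3), of x "l j"] assms(4) arr_nat(3)[OF assms(2)]
    by simp
qed

lemma cocone_merge:
  assumes "is_cocone I (set_functor_cat U) \<Gamma> L l" "X \<in> U" "x \<in> El i X" "y \<in> El j X"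
    and "merge X i x j y"
  shows "cm (l i) X x = cm (l j) X y"
  using assms(5) cocone_tr[OF assms(1) _ assms(2,3)] cocone_tr[OF assms(1) _ assms(2,4)]
  unfolding merge_def by metis

lemma is_coconeI:
  assumes "is_functor S S L"
    and leg: "\<And>i. i \<in> Obj I \<Longrightarrow> is_nat_trans S S (l i) \<and> NDom (l i) = OMap \<Gamma> i \<and> NCod (l i) = L"
    and tr: "\<And>i j f X x. f \<in> Hom I i j \<Longrightarrow> X \<in> U \<Longrightarrow> x \<in> El i X \<Longrightarrow>
      cm (l j) X (tr f X x) = cm (l i) X x"
  shows "is_cocone I (set_functor_cat U) \<Gamma> L l"
  unfolding is_cocone_def
proof (intro conjI allI ballI)
  show "L \<in> Obj (set_functor_cat U)"
    using assms(1) by simp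
  show "l i \<in> Hom (set_functor_cat U) (OMap \<Gamma> i) L" if "i \<in> Obj I" for i
    using leg[OF that] by (simp add: hom_functor_cat)
  show "Comp (set_functor_cat U) (l j) (AMap \<Gamma> f) = l i" if f: "f \<in> Hom I i j" for i j f
  proof (rule nat_trans_eqI)
    have ij: "i \<in> Obj I" "j \<in> Obj I"
      using hom_obj[OF f] by auto
    note li = leg[OF ij(1)] and lj = leg[OF ij(2)] and nf = arr_nat[OF f]
    show "is_nat_trans S S (Comp (set_functor_cat U) (l j) (AMap \<Gamma> f))"
      using lj nf by (intro is_nat_trans_Comp) simp_all
    show "is_nat_trans S S (l i)" "NDom (Comp (set_functor_cat U) (l j) (AMap \<Gamma> f)) = NDom (l i)"
      "NCod (Comp (set_functor_cat U) (l j) (AMap \<Gamma> f)) = NCod (l i)"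
      using li lj nf by simp_all
    fix X x assume X: "X \<in> U" and "x \<in> OMap (NDom (Comp (set_functor_cat U) (l j) (AMap \<Gamma> f))) X"
    then have x: "x \<in> El i X" "x \<in> OMap (NDom (AMap \<Gamma> f)) X"
      using nf by simp_all
    show "cm (Comp (set_functor_cat U) (l j) (AMap \<Gamma> f)) X x = cm (l i) X x"
      using cm_Comp[OF nf(1) X x(2)] tr[OF f X x(1)] by simp
  qed
qed

section \<open>Merging as an equivalence relation\<close>

lemma merge_refl: "i \<in> Obj I \<Longrightarrow> merge X i x i x"
  unfolding merge_def using I.id_hom by blast

lemma merge_sym: "merge X i x j y \<Longrightarrow> merge X j y i x"
  unfolding merge_def by metis

text \<open>The arrows g and f' used for y both start at j. Confluence closes this span, and at its
  closing stage x, y and z have a common image.\<close>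

lemma merge_trans:
  assumes X: "X \<in> U" and x: "x \<in> El i X" and y: "y \<in> El j X" and z: "z \<in> El k X"
    and xy: "merge X i x j y" and yz: "merge X j y k z"
  shows "merge X i x k z"
proof -
  obtain a f g where f: "f \<in> Hom I i a" and g: "g \<in> Hom I j a" and fg: "tr f X x = tr g X y"
    using xy unfolding merge_def by blast
  obtain b f' g' where f': "f' \<in> Hom I j b" and g': "g' \<in> Hom I k b" and fg': "tr f' X y = tr g' X z"
    using yz unfolding merge_def by blast
  have "g \<in> Arr I" "f' \<in> Arr I" "Dom I g = Dom I f'" "Cod I g = a" "Cod I f' = b"
    using g f' by (auto simp: Hom_def)
  then obtain n h h' where h: "h \<in> Hom I a n" and h': "h' \<in> Hom I b n"
    and eq: "Comp I h g = Comp I h' f'"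
    using confluent unfolding confluent_def by metis
  have "tr (Comp I h f) X x = tr (Comp I h g) X y"
    using tr_Comp[OF f h X x] tr_Comp[OF g h X y] fg by simp
  also have "\<dots> = tr (Comp I h' g') X z"
    unfolding eq using tr_Comp[OF f' h' X y] tr_Comp[OF g' h' X z] fg' by simp
  finally show ?thesis
    unfolding merge_def using I.comp_hom[OF f h] I.comp_hom[OF g' h'] by blast
qed

text \<open>Follows from naturality of the two transition maps, and makes the action of the explicit
  colimit on classes well defined.\<close>

lemma merge_ap:
  assumes h: "h \<in> Hom S X Y" and x: "x \<in> El i X" and y: "y \<in> El j X" and "merge X i x j y"
  shows "merge Y i (ap (OMap \<Gamma> i) h x) j (ap (OMap \<Gamma> j) h y)"
proof -
  obtain k f g where f: "f \<in> Hom I i k" and g: "g \<in> Hom I j k" and fg: "tr f X x = tr g X y"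
    using assms(4) unfolding merge_def by blast
  have "tr f Y (ap (OMap \<Gamma> i) h x) = tr g Y (ap (OMap \<Gamma> j) h y)"
    using tr_natural[OF f h x] tr_natural[OF g h y] fg by simp
  then show ?thesis
    unfolding merge_def using f g by blast
qed

section \<open>The elementwise description of colimits\<close>

lemma pointwise_colimitD:
  assumes "pointwise_colimit L l"
  shows "is_cocone I (set_functor_cat U) \<Gamma> L l"
    and "\<And>X z. X \<in> U \<Longrightarrow> z \<in> OMap L X \<Longrightarrow> \<exists>i x. i \<in> Obj I \<and> x \<in> El i X \<and> z = cm (l i) X x"
    and "\<And>X i j x y. X \<in> U \<Longrightarrow> i \<in> Obj I \<Longrightarrow> j \<in> Obj I \<Longrightarrow> x \<in> El i X \<Longrightarrow> y \<in> El j X \<Longrightarrow>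
      cm (l i) X x = cm (l j) X y \<Longrightarrow> merge X i x j y"
  using assms unfolding pointwise_colimit_def by blast+

text \<open>A transformation out of L is forced by the jointly surjective legs, and it exists
  because every cocone identifies merged elements.\<close>

lemma pointwise_colimit_is_colimit:
  assumes L: "pointwise_colimit L l"
  shows "is_colimit I (set_functor_cat U) \<Gamma> L l"
  unfolding is_colimit_def
proof (intro conjI allI impI)
  note cL = pointwise_colimitD(1)[OF L] and surj = pointwise_colimitD(2)[OF L]
    and inj = pointwise_colimitD(3)[OF L]
  show "is_cocone I (set_functor_cat U) \<Gamma> L l"
    by (rule cL)
  fix K k assume cK: "is_cocone I (set_functor_cat U) \<Gamma> K k"
  \<comment> \<open>The value at z is read off from some representative; the fact proved next shows
    that it does not depend on the choice.\<close>
  define h where "h X z = (SOME w. \<exists>i x. i \<in> Obj I \<and> x \<in> El i X \<and> z = cm (l i) X x \<and> w = cm (k i) X x)"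
    for X z
  have h: "h X (cm (l i) X x) = cm (k i) X x" if X: "X \<in> U" and i: "i \<in> Obj I" and x: "x \<in> El i X" for X i x
    unfolding h_def
  proof (rule some_equality)
    show "\<exists>j y. j \<in> Obj I \<and> y \<in> El j X \<and> cm (l i) X x = cm (l j) X y \<and> cm (k i) X x = cm (k j) X y"
      using i x by blast
    show "w = cm (k i) X x"
      if "\<exists>j y. j \<in> Obj I \<and> y \<in> El j X \<and> cm (l i) X x = cm (l j) X y \<and> w = cm (k j) X y" for w
      using that inj[OF X i _ x] cocone_merge[OF cK X x] by metis
  qed
  have Lf: "is_functor S S L" and Kf: "is_functor S S K"
    using cL cK by (simp_all add: is_cocone_def)
  define H where "H = mk_nat_trans U L K h"
  have H_ends: "NDom H = L" "NCod H = K"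
    by (simp_all add: H_def)
  have H: "is_nat_trans S S H"
    unfolding H_def
  proof (rule is_nat_trans_mk[OF Lf Kf])
    show "h X z \<in> OMap K X" if "X \<in> U" "z \<in> OMap L X" for X z
      using surj[OF that] h[OF that(1)] cocone_in[OF cK _ that(1)] by metis
    show "h Y (ap L f z) = ap K f (h X z)" if f: "f \<in> Hom S X Y" and z: "z \<in> OMap L X" for X Y f z
    proof -
      have XY: "X \<in> U" "Y \<in> U"
        using f by (auto simp: hom_set_cat)
      obtain i x where x: "i \<in> Obj I" "x \<in> El i X" "z = cm (l i) X x"
        using surj[OF XY(1) z] by blast
      show ?thesis
        using cocone_natural[OF cL x(1) f x(2)] cocone_natural[OF cK x(1) f x(2)] h[OF XY(1) x(1,2)]
          h[OF XY(2) x(1) ap_in[OF functor_obj[OF x(1)] f x(2)]] x(3) by simp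
    qed
  qed
  have Hl: "cm H X (cm (l i) X x) = cm (k i) X x" if "X \<in> U" "i \<in> Obj I" "x \<in> El i X" for X i x
    using h[OF that] cocone_in[OF cL that(2,1,3)] that(1) by (simp add: H_def)
  have comp: "Comp (set_functor_cat U) H (l i) = k i" if i: "i \<in> Obj I" for i
  proof (rule nat_trans_eqI)
    note li = cocone_leg[OF cL i] and ki = cocone_leg[OF cK i]
    show "is_nat_trans S S (Comp (set_functor_cat U) H (l i))"
      using H li by (intro is_nat_trans_Comp) (simp_all add: H_ends)
    show "is_nat_trans S S (k i)" "NDom (Comp (set_functor_cat U) H (l i)) = NDom (k i)"
      "NCod (Comp (set_functor_cat U) H (l i)) = NCod (k i)"
      using li ki by (simp_all add: H_ends)
    fix X x assume X: "X \<in> U" and "x \<in> OMap (NDom (Comp (set_functor_cat U) H (l i))) X"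
    then have x: "x \<in> OMap (NDom (l i)) X"
      by simp
    then show "cm (Comp (set_functor_cat U) H (l i)) X x = cm (k i) X x"
      using cm_Comp[OF li(1) X x] Hl[OF X i] li(2) by simp
  qed
  show "\<exists>!h. h \<in> Hom (set_functor_cat U) L K \<and> (\<forall>i\<in>Obj I. Comp (set_functor_cat U) h (l i) = k i)"
  proof (rule ex1I)
    show "H \<in> Hom (set_functor_cat U) L K \<and> (\<forall>i\<in>Obj I. Comp (set_functor_cat U) H (l i) = k i)"
      using H H_ends comp by (simp add: hom_functor_cat)
    fix G assume G: "G \<in> Hom (set_functor_cat U) L K \<and> (\<forall>i\<in>Obj I. Comp (set_functor_cat U) G (l i) = k i)"
    then have nG: "is_nat_trans S S G" "NDom G = L" "NCod G = K"
      by (simp_all add: hom_functor_cat)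
    show "G = H"
    proof (rule nat_trans_eqI[OF nG(1) H])
      fix X z assume X: "X \<in> U" and "z \<in> OMap (NDom G) X"
      then obtain i x where x: "i \<in> Obj I" "x \<in> El i X" "z = cm (l i) X x"
        using surj nG(2) by metis
      have "cm (Comp (set_functor_cat U) G (l i)) X x = cm G X z"
        using cm_Comp[OF cocone_leg(1)[OF cL x(1)] X, of x] cocone_leg(2)[OF cL x(1)] x by simp
      then show "cm G X z = cm H X z"
        using G x Hl[OF X x(1,2)] by simp
    qed (simp_all add: nG H_ends)
  qed
qed

text \<open>By confluence \<^const>\<open>merge\<close> is an equivalence relation on the disjoint union of the sets
  \<open>El i X\<close>. The colimit consists of codes in \<open>'u\<close> of chosen representatives of its classes, a code
  being a pair encoded by an injection \<open>\<pi> :: 'u \<times> 'u \<Rightarrow> 'u\<close>.\<close>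

lemma pointwise_colimit_exists: "\<exists>L l. pointwise_colimit L l"
proof -
  obtain \<pi> :: "'u \<times> 'u \<Rightarrow> 'u" where \<pi>: "inj \<pi>"
    using ex_pairing by blast
  obtain \<iota> :: "'i \<Rightarrow> 'u" where \<iota>: "inj_on \<iota> (Obj I)" "\<iota> ` Obj I \<in> U"
    using small unfolding small_set_def by blast
  define cls where "cls X i x = {(j, y). j \<in> Obj I \<and> y \<in> El j X \<and> merge X i x j y}" for X i x
  \<comment> \<open>The choice depends on i and x only through the class \<open>cls X i x\<close>,
    so merged elements receive the same code.\<close>
  define rep where "rep X i x = (case SOME p. p \<in> cls X i x of (j, y) \<Rightarrow> \<pi> (\<iota> j, y))" for X i x
  have rep: "\<exists>j y. (j, y) \<in> cls X i x \<and> rep X i x = \<pi> (\<iota> j, y)"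
    if "i \<in> Obj I" "x \<in> El i X" for X i x
  proof -
    have "(i, x) \<in> cls X i x"
      using that merge_refl by (simp add: cls_def)
    then have "(SOME p. p \<in> cls X i x) \<in> cls X i x"
      by (rule someI)
    then show ?thesis
      unfolding rep_def by (cases "SOME p. p \<in> cls X i x") auto
  qed
  have rep_eq: "rep X i x = rep X j y \<longleftrightarrow> merge X i x j y"
    if X: "X \<in> U" and i: "i \<in> Obj I" and x: "x \<in> El i X" and j: "j \<in> Obj I" and y: "y \<in> El j X"
    for X i x j y
  proof
    assume "merge X i x j y"
    then have "cls X i x = cls X j y"
      using merge_trans[OF X x y] merge_trans[OF X y x] merge_sym unfolding cls_def by blast
    then show "rep X i x = rep X j y"
      by (simp add: rep_def)
  next
    assume eq: "rep X i x = rep X j y"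
    obtain i' x' j' y' where *: "(i', x') \<in> cls X i x" "rep X i x = \<pi> (\<iota> i', x')"
      "(j', y') \<in> cls X j y" "rep X j y = \<pi> (\<iota> j', y')"
      using rep[OF i x] rep[OF j y] by blast
    then have "\<iota> i' = \<iota> j'" "x' = y'"
      using \<pi> eq by (auto simp: inj_eq)
    \<comment> \<open>\<iota> is injective only on \<open>Obj I\<close>; that i' and j' lie there is
      recorded in \<open>cls\<close>.\<close>
    then have "i' = j'"
      using * \<iota>(1) by (auto simp: cls_def dest: inj_onD)
    then show "merge X i x j y"
      using * \<open>x' = y'\<close> merge_trans[OF X x _ y] merge_sym by (auto simp: cls_def)
  qed
  define Ob where "Ob X = {rep X i x | i x. i \<in> Obj I \<and> x \<in> El i X}" for X
  define act where "act h z = (SOME w. \<exists>i x. i \<in> Obj I \<and> x \<in> El i (src h) \<and> z = rep (src h) i x \<and>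
    w = rep (tgt h) i (ap (OMap \<Gamma> i) h x))" for h z
  have act: "act h (rep X i x) = rep Y i (ap (OMap \<Gamma> i) h x)"
    if h: "h \<in> Hom S X Y" and i: "i \<in> Obj I" and x: "x \<in> El i X" for h X Y i x
  proof -
    have h': "src h = X" "tgt h = Y" "X \<in> U" "Y \<in> U"
      using h by (auto simp: hom_set_cat)
    show ?thesis
      unfolding act_def h'
    proof (rule some_equality)
      fix w assume "\<exists>j y. j \<in> Obj I \<and> y \<in> El j X \<and> rep X i x = rep X j y \<and>
        w = rep Y j (ap (OMap \<Gamma> j) h y)"
      then obtain j y where y: "j \<in> Obj I" "y \<in> El j X" "rep X i x = rep X j y"
        "w = rep Y j (ap (OMap \<Gamma> j) h y)"
        by blast
      have "merge Y i (ap (OMap \<Gamma> i) h x) j (ap (OMap \<Gamma> j) h y)"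
        using rep_eq[OF h'(3) i x y(1,2)] y(3) merge_ap[OF h x y(2)] by blast
      then show "w = rep Y i (ap (OMap \<Gamma> i) h x)"
        using rep_eq[OF h'(4) i ap_in[OF functor_obj[OF i] h x] y(1) ap_in[OF functor_obj[OF y(1)] h y(2)]]
          y(4) by simp
    qed (use i x in blast)
  qed
  have Ob_in: "Ob X \<in> U" if X: "X \<in> U" for X
  proof (rule subset_closed)
    \<comment> \<open>The index set in \<open>Union_closed\<close> has to be a member of
      \<open>U\<close>, so the union runs over the codes of the objects, and \<open>inv_into\<close>
      recovers the object.\<close>
    have "(\<Union>s\<in>\<iota> ` Obj I. (\<lambda>x. \<pi> (s, x)) ` El (inv_into (Obj I) \<iota> s) X) \<in> U"
    proof (rule Union_closed[OF \<iota>(2)])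
      fix s assume "s \<in> \<iota> ` Obj I"
      then show "(\<lambda>x. \<pi> (s, x)) ` El (inv_into (Obj I) \<iota> s) X \<in> U"
        using is_functorD(1)[OF functor_obj X] by (intro image_closed) (auto simp: \<iota>(1))
    qed
    then show "(\<Union>j\<in>Obj I. (\<lambda>x. \<pi> (\<iota> j, x)) ` El j X) \<in> U"
      by (simp add: \<iota>(1))
    show "Ob X \<subseteq> (\<Union>j\<in>Obj I. (\<lambda>x. \<pi> (\<iota> j, x)) ` El j X)"
      using rep unfolding Ob_def cls_def by fastforce
  qed
  define L where "L = mk_functor U Ob act"
  have Lf: "is_functor S S L"
    unfolding L_def
  proof (rule is_functor_mk)
    show "Ob X \<in> U" if "X \<in> U" for X
      by (rule Ob_in[OF that])
    show "act f z \<in> Ob Y" if f: "f \<in> Hom S X Y" and z: "z \<in> Ob X" for X Y f z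
    proof -
      obtain i x where x: "i \<in> Obj I" "x \<in> El i X" "z = rep X i x"
        using z unfolding Ob_def by blast
      then show ?thesis
        using act[OF f x(1,2)] ap_in[OF functor_obj[OF x(1)] f x(2)] unfolding Ob_def by blast
    qed
    show "act (Id S X) z = z" if X: "X \<in> U" and z: "z \<in> Ob X" for X z
    proof -
      obtain i x where x: "i \<in> Obj I" "x \<in> El i X" "z = rep X i x"
        using z unfolding Ob_def by blast
      have "Id S X \<in> Hom S X X"
        using category.id_hom[OF category_set_cat] X by simp
      then show ?thesis
        using act[OF _ x(1,2)] ap_id[OF functor_obj[OF x(1)] X x(2)] x(3) by metis
    qed
    show "act (Comp S g f) z = act g (act f z)"
      if f: "f \<in> Hom S X Y" and g: "g \<in> Hom S Y Z" and z: "z \<in> Ob X" for X Y Z f g z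
    proof -
      obtain i x where x: "i \<in> Obj I" "x \<in> El i X" "z = rep X i x"
        using z unfolding Ob_def by blast
      show ?thesis
        using act[OF f x(1,2)] act[OF g x(1) ap_in[OF functor_obj[OF x(1)] f x(2)]] x(3)
          act[OF category.comp_hom[OF category_set_cat f g] x(1,2)]
          ap_comp[OF functor_obj[OF x(1)] f g x(2)] by metis
    qed
  qed
  define l where "l i = mk_nat_trans U (OMap \<Gamma> i) L (\<lambda>X x. rep X i x)" for i
  have OL: "OMap L X = Ob X" if "X \<in> U" for X
    using that by (simp add: L_def)
  have l: "cm (l i) X x = rep X i x" if "X \<in> U" "x \<in> El i X" for i X x
    using that by (simp add: l_def)
  have "is_cocone I (set_functor_cat U) \<Gamma> L l"
  proof (rule is_coconeI[OF Lf])
    fix i assume i: "i \<in> Obj I"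
    have "is_nat_trans S S (l i)"
      unfolding l_def
    proof (rule is_nat_trans_mk[OF functor_obj[OF i] Lf])
      show "rep X i x \<in> OMap L X" if "X \<in> U" "x \<in> El i X" for X x
        using that i OL by (auto simp: Ob_def)
      show "rep Y i (ap (OMap \<Gamma> i) f x) = ap L f (rep X i x)"
        if f: "f \<in> Hom S X Y" and x: "x \<in> El i X" for X Y f x
      proof -
        have "rep X i x \<in> Ob X"
          using i x by (auto simp: Ob_def)
        then show ?thesis
          using act[OF f i x] arr_of_hom[OF f] by (simp add: L_def)
      qed
    qed
    then show "is_nat_trans S S (l i) \<and> NDom (l i) = OMap \<Gamma> i \<and> NCod (l i) = L"
      by (simp add: l_def)
  next
    fix i j f X x assume f: "f \<in> Hom I i j" and X: "X \<in> U" and x: "x \<in> El i X"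
    have ij: "i \<in> Obj I" "j \<in> Obj I" and x': "tr f X x \<in> El j X"
      using hom_obj[OF f] tr_in[OF f X x] by auto
    \<comment> \<open>The cospan consists of the identity at j and of f.\<close>
    have "merge X j (tr f X x) i x"
      unfolding merge_def using f I.id_hom[OF ij(2)] tr_Id[OF ij(2) X x'] by metis
    then show "cm (l j) X (tr f X x) = cm (l i) X x"
      using rep_eq[OF X ij(2) x' ij(1) x] l[OF X x] l[OF X x'] by simp
  qed
  moreover have "\<forall>X\<in>U. \<forall>z\<in>OMap L X. \<exists>i\<in>Obj I. \<exists>x\<in>El i X. z = cm (l i) X x"
    using l OL unfolding Ob_def by fastforce
  moreover have "\<forall>X\<in>U. \<forall>i\<in>Obj I. \<forall>j\<in>Obj I. \<forall>x\<in>El i X. \<forall>y\<in>El j X.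
      cm (l i) X x = cm (l j) X y \<longrightarrow> merge X i x j y"
    using l rep_eq by simp
  ultimately show ?thesis
    unfolding pointwise_colimit_def by blast
qed

text \<open>The comparison isomorphism with the explicit colimit commutes with the legs. Its
  surjectivity carries over joint surjectivity, and its injectivity reduces equal leg values to
  equal values in the explicit colimit.\<close>

lemma is_colimit_pointwise:
  assumes "is_colimit I (set_functor_cat U) \<Gamma> L l"
  shows "pointwise_colimit L l"
proof -
  obtain L' l' where L': "pointwise_colimit L' l'"
    using pointwise_colimit_exists by blast
  obtain f g where f: "f \<in> Hom (set_functor_cat U) L' L" and g: "g \<in> Hom (set_functor_cat U) L L'"
    and gf: "Comp (set_functor_cat U) g f = Id (set_functor_cat U) L'"
    and fg: "Comp (set_functor_cat U) f g = Id (set_functor_cat U) L"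
    and fl: "\<And>i. i \<in> Obj I \<Longrightarrow> Comp (set_functor_cat U) f (l' i) = l i"
    using colimit_unique[OF category_set_functor_cat pointwise_colimit_is_colimit[OF L'] assms] by blast
  have nf: "is_nat_trans S S f" "NDom f = L'" "NCod f = L"
    and ng: "is_nat_trans S S g" "NDom g = L" "NCod g = L'"
    using f g by (simp_all add: hom_functor_cat)
  note c' = pointwise_colimitD(1)[OF L'] and surj = pointwise_colimitD(2)[OF L']
    and inj = pointwise_colimitD(3)[OF L']
  have fl': "cm f X (cm (l' i) X x) = cm (l i) X x" if "X \<in> U" "i \<in> Obj I" "x \<in> El i X" for X i x
    using cm_Comp[OF cocone_leg(1)[OF c' that(2)] that(1), of x f] cocone_leg(2)[OF c' that(2)] fl that
    by simp
  have gf': "cm g X (cm f X z) = z" if "X \<in> U" "z \<in> OMap L' X" for X z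
    using cm_Comp[OF nf(1) that(1), of z g] cm_Id[OF that] gf that(2) nf(2) by simp
  have fg': "cm f X (cm g X z) = z" if "X \<in> U" "z \<in> OMap L X" for X z
    using cm_Comp[OF ng(1) that(1), of z f] cm_Id[OF that] fg that(2) ng(2) by simp
  have "\<exists>i\<in>Obj I. \<exists>x\<in>El i X. z = cm (l i) X x" if X: "X \<in> U" and z: "z \<in> OMap L X" for X z
  proof -
    have "cm g X z \<in> OMap L' X"
      using cm_in[OF ng(1) X] z ng by simp
    then obtain i x where "i \<in> Obj I" "x \<in> El i X" "cm g X z = cm (l' i) X x"
      using surj[OF X] by blast
    then show ?thesis
      using fl'[OF X] fg'[OF X z] by metis
  qed
  moreover have "merge X i x j y"
    if X: "X \<in> U" and i: "i \<in> Obj I" and j: "j \<in> Obj I" and x: "x \<in> El i X" and y: "y \<in> El j X"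
      and eq: "cm (l i) X x = cm (l j) X y" for X i j x y
  proof (rule inj[OF X i j x y])
    show "cm (l' i) X x = cm (l' j) X y"
      using eq fl'[OF X i x] fl'[OF X j y] gf'[OF X cocone_in[OF c' i X x]]
        gf'[OF X cocone_in[OF c' j X y]] by metis
  qed
  moreover have "is_cocone I (set_functor_cat U) \<Gamma> L l"
    using assms by (simp add: is_colimit_def)
  ultimately show ?thesis
    unfolding pointwise_colimit_def by blast
qed

text \<open>This is where tautness of the diagram's transition maps enters: at a stage of \<open>I\<close> where \<open>y\<close>
  and a representative of \<open>z\<close> are merged, the naturality square of the transition map is a pullback.\<close>

lemma pointwise_colimit_lift:
  assumes L: "pointwise_colimit L l" and i: "i \<in> Obj I"
    and m: "m \<in> Hom S A B" "inj_on (fn m) A"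
    and y: "y \<in> El i B" and z: "z \<in> OMap L A" and eq: "cm (l i) B y = ap L m z"
  shows "\<exists>u. u \<in> El i A \<and> ap (OMap \<Gamma> i) m u = y \<and> cm (l i) A u = z"
proof -
  note cL = pointwise_colimitD(1)[OF L] and surj = pointwise_colimitD(2)[OF L]
    and inj = pointwise_colimitD(3)[OF L]
  have AB: "A \<in> U" "B \<in> U"
    using m by (auto simp: hom_set_cat)
  obtain j w where w: "j \<in> Obj I" "w \<in> El j A" "z = cm (l j) A w"
    using surj[OF AB(1) z] by blast
  have mw: "ap (OMap \<Gamma> j) m w \<in> El j B"
    by (rule ap_in[OF functor_obj[OF w(1)] m(1) w(2)])
  have "cm (l i) B y = cm (l j) B (ap (OMap \<Gamma> j) m w)"
    using eq cocone_natural[OF cL w(1) m(1) w(2)] w(3) by simp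
  then have "merge B i y j (ap (OMap \<Gamma> j) m w)"
    by (rule inj[OF AB(2) i w(1) y mw])
  then obtain k f g where f: "f \<in> Hom I i k" and g: "g \<in> Hom I j k"
    and fg: "tr f B y = tr g B (ap (OMap \<Gamma> j) m w)"
    unfolding merge_def by blast
  have "tr f B y = ap (OMap \<Gamma> k) m (tr g A w)"
    using fg tr_natural[OF g m(1) w(2)] by simp
  then have "\<exists>u. u \<in> El i A \<and> ap (OMap \<Gamma> i) m u = y \<and> tr f A u = tr g A w"
    using taut_nat_transD[OF arr_nat(2)[OF f] m] y tr_in[OF g AB(1) w(2)] arr_nat(3,4)[OF f] by simp
  then obtain u where u: "u \<in> El i A" "ap (OMap \<Gamma> i) m u = y" "tr f A u = tr g A w"
    by blast
  \<comment> \<open>u and w have the same image at stage k, hence the same image in the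
    colimit.\<close>
  have "cm (l i) A u = z"
    using cocone_tr[OF cL f AB(1) u(1)] cocone_tr[OF cL g AB(1) w(2)] u(3) w(3) by simp
  then show ?thesis
    using u by blast
qed

text \<open>A representative of one element fixes a stage i, and
  \<open>pointwise_colimit_lift\<close> produces a representative of the other at that same stage.
  Injectivity and the pullback lift are then those of the taut functor
  \<open>OMap \<Gamma> i\<close>.\<close>

lemma pointwise_colimit_taut:
  assumes L: "pointwise_colimit L l"
  shows "taut_functor U L"
proof (rule taut_functorI)
  note cL = pointwise_colimitD(1)[OF L] and surj = pointwise_colimitD(2)[OF L]
  show "is_functor S S L"
    using cL by (simp add: is_cocone_def)
  show "inj_on (ap L m) (OMap L (src m))" if m: "m \<in> Arr S" "inj_on (fn m) (src m)" for m
  proof (rule inj_onI)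
    fix z w assume z: "z \<in> OMap L (src m)" and w: "w \<in> OMap L (src m)" and eq: "ap L m z = ap L m w"
    have hom: "m \<in> Hom S (src m) (tgt m)" and U: "src m \<in> U"
      using m(1) by (simp_all add: Hom_def arr_set_cat)
    obtain i x where x: "i \<in> Obj I" "x \<in> El i (src m)" "z = cm (l i) (src m) x"
      using surj[OF U z] by blast
    have "cm (l i) (tgt m) (ap (OMap \<Gamma> i) m x) = ap L m w"
      using cocone_natural[OF cL x(1) hom x(2)] x(3) eq by simp
    then obtain u where u: "u \<in> El i (src m)" "ap (OMap \<Gamma> i) m u = ap (OMap \<Gamma> i) m x" "cm (l i) (src m) u = w"
      using pointwise_colimit_lift[OF L x(1) hom m(2) ap_in[OF functor_obj[OF x(1)] hom x(2)] w] by blast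
    have "u = x"
      by (rule inj_onD[OF taut_functor_inj[OF taut_obj[OF x(1)] m] u(2,1) x(2)])
    then show "z = w"
      using u x by simp
  qed
  fix p q f m a b
  assume arr: "{p, q, f, m} \<subseteq> Arr S" and m: "inj_on (fn m) (src m)" and pb: "set_pullback p q f m"
    and a: "a \<in> OMap L (src f)" and b: "b \<in> OMap L (src m)" and eq: "ap L f a = ap L m b"
  have sq: "src p = src q" "tgt p = src f" "tgt q = src m" "tgt f = tgt m"
    using pb unfolding set_pullback_def by blast+
  have hom: "p \<in> Hom S (src p) (src f)" "q \<in> Hom S (src p) (src m)"
    "f \<in> Hom S (src f) (tgt m)" "m \<in> Hom S (src m) (tgt m)"
    and U: "src p \<in> U" "src f \<in> U" "src m \<in> U"
    using arr sq by (auto simp: Hom_def arr_set_cat)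
  obtain i x where x: "i \<in> Obj I" "x \<in> El i (src f)" "a = cm (l i) (src f) x"
    using surj[OF U(2) a] by blast
  have "cm (l i) (tgt m) (ap (OMap \<Gamma> i) f x) = ap L m b"
    using cocone_natural[OF cL x(1) hom(3) x(2)] x(3) eq by simp
  then obtain w where w: "w \<in> El i (src m)" "ap (OMap \<Gamma> i) m w = ap (OMap \<Gamma> i) f x" "cm (l i) (src m) w = b"
    using pointwise_colimit_lift[OF L x(1) hom(4) m ap_in[OF functor_obj[OF x(1)] hom(3) x(2)] b] by blast
  obtain u where u: "u \<in> El i (src p)" "ap (OMap \<Gamma> i) p u = x" "ap (OMap \<Gamma> i) q u = w"
    using taut_functor_pb[OF taut_obj[OF x(1)] arr m pb x(2) w(1) w(2)[symmetric]] by blast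
  show "\<exists>u. u \<in> OMap L (src p) \<and> ap L p u = a \<and> ap L q u = b"
    using cocone_in[OF cL x(1) U(1) u(1)] cocone_natural[OF cL x(1) hom(1) u(1)]
      cocone_natural[OF cL x(1) hom(2) u(1)] u x w by (intro exI[of _ "cm (l i) (src p) u"]) simp
qed

text \<open>For a leg, the lifting condition of \<open>taut_nat_transI\<close> is exactly
  \<open>pointwise_colimit_lift\<close>.\<close>

lemma pointwise_colimit_leg_taut:
  assumes L: "pointwise_colimit L l" and i: "i \<in> Obj I"
  shows "taut_nat_trans U (l i)"
proof (rule taut_nat_transI)
  note li = cocone_leg[OF pointwise_colimitD(1)[OF L] i]
  show "is_nat_trans S S (l i)" "taut_functor U (NDom (l i))"
    using li taut_obj[OF i] by simp_all
  show "\<exists>u. u \<in> OMap (NDom (l i)) A \<and> ap (NDom (l i)) m u = y \<and> cm (l i) A u = z"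
    if "m \<in> Hom S A B" "inj_on (fn m) A" "y \<in> OMap (NDom (l i)) B" "z \<in> OMap (NCod (l i)) A"
      "cm (l i) B y = ap (NCod (l i)) m z" for A B m y z
    using pointwise_colimit_lift[OF L i that(1,2)] that(3-5) li by simp
qed

section \<open>The diagram of difference functors and its colimit\<close>

abbreviation \<Gamma>\<Delta> where "\<Gamma>\<Delta> \<equiv> comp_functor I (Delta U) \<Gamma>"

lemma taut_diagram_Delta: "taut_diagram U I \<Gamma>\<Delta>"
  using is_functor_comp[OF I.category_axioms functor_diagram is_functor_Delta] confluent small
  by unfold_locales

lemma Delta_diagram:
  shows "i \<in> Obj I \<Longrightarrow> OMap \<Gamma>\<Delta> i = diff_obj U (OMap \<Gamma> i)"
    and "f \<in> Hom I i j \<Longrightarrow> AMap \<Gamma>\<Delta> f = diff_arr U (AMap \<Gamma> f)"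
  using taut_obj[of i] arr_hom_taut[of f i j] by (auto simp: comp_functor_def Delta_def Hom_def)

text \<open>The colimit conditions at X are those for L at X + 1, restricted to difference sets. By
  \<open>leg_iff\<close>, every representative of an element of the difference set of L lies in the
  difference set of its own stage.\<close>

lemma pointwise_colimit_Delta:
  assumes L: "pointwise_colimit L l"
  shows "taut_diagram.pointwise_colimit U I \<Gamma>\<Delta> (diff_obj U L) (\<lambda>i. diff_arr U (l i))"
proof -
  interpret D: taut_diagram U I "\<Gamma>\<Delta>"
    by (rule taut_diagram_Delta)
  note cL = pointwise_colimitD(1)[OF L] and surj = pointwise_colimitD(2)[OF L]
    and inj = pointwise_colimitD(3)[OF L]
  note Lt = pointwise_colimit_taut[OF L]
  have El: "D.El i X = diff_set (OMap \<Gamma> i) X" if "i \<in> Obj I" "X \<in> U" for i X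
    using Delta_diagram(1)[OF that(1)] that(2) by simp
  have tr: "D.tr f X x = tr f (plus1 X) x"
    if "f \<in> Hom I i j" "X \<in> U" "x \<in> diff_set (OMap \<Gamma> i) X" for f i j X x
    using Delta_diagram(2)[OF that(1)] that arr_nat(3)[OF that(1)] by simp
  have leg: "cm (diff_arr U (l i)) X x = cm (l i) (plus1 X) x"
    if "i \<in> Obj I" "X \<in> U" "x \<in> diff_set (OMap \<Gamma> i) X" for i X x
    using that cocone_leg(2)[OF cL that(1)] by simp
  have leg_iff: "cm (l i) (plus1 X) x \<in> diff_set L X \<longleftrightarrow> x \<in> diff_set (OMap \<Gamma> i) X"
    if "i \<in> Obj I" "X \<in> U" "x \<in> El i (plus1 X)" for i X x
    using cm_plus1_diff_iff[OF pointwise_colimit_leg_taut[OF L that(1)] that(2)] that(3)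
      cocone_leg[OF cL that(1)] by simp
  have "is_cocone I (set_functor_cat U) \<Gamma>\<Delta> (diff_obj U L) (\<lambda>i. diff_arr U (l i))"
  proof (rule D.is_coconeI)
    show "is_functor S S (diff_obj U L)"
      by (rule is_functor_diff_obj[OF Lt])
    show "is_nat_trans S S (diff_arr U (l i)) \<and> NDom (diff_arr U (l i)) = OMap \<Gamma>\<Delta> i \<and>
      NCod (diff_arr U (l i)) = diff_obj U L" if i: "i \<in> Obj I" for i
      using taut_diff_arr[OF pointwise_colimit_leg_taut[OF L i]] taut_obj[OF i] Lt
        cocone_leg[OF cL i] Delta_diagram(1)[OF i] by (simp add: taut_nat_trans_def)
    show "cm (diff_arr U (l j)) X (D.tr f X x) = cm (diff_arr U (l i)) X x"
      if f: "f \<in> Hom I i j" and X: "X \<in> U" and x: "x \<in> D.El i X" for i j f X x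
    proof -
      have ij: "i \<in> Obj I" "j \<in> Obj I"
        using hom_obj[OF f] by auto
      then have x': "x \<in> diff_set (OMap \<Gamma> i) X" "x \<in> El i (plus1 X)"
        using x El[OF _ X] by (auto simp: diff_set_iff)
      \<comment> \<open>Only on the difference set may the leg at j be replaced by its unrestricted
        form at X + 1.\<close>
      have "D.tr f X x \<in> diff_set (OMap \<Gamma> j) X"
        using D.tr_in[OF f X x] El[OF ij(2) X] by simp
      then show ?thesis
        using leg[OF ij(2) X] leg[OF ij(1) X x'(1)] tr[OF f X x'(1)]
          cocone_tr[OF cL f plus1_in[OF X] x'(2)] by simp
    qed
  qed
  moreover have "\<exists>i\<in>Obj I. \<exists>x\<in>D.El i X. z = cm (diff_arr U (l i)) X x"
    if X: "X \<in> U" and "z \<in> OMap (diff_obj U L) X" for X z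
  proof -
    have z: "z \<in> diff_set L X" "z \<in> OMap L (plus1 X)"
      using that by (auto simp: diff_set_iff)
    obtain i x where x: "i \<in> Obj I" "x \<in> El i (plus1 X)" "z = cm (l i) (plus1 X) x"
      using surj[OF plus1_in[OF X] z(2)] by blast
    have "x \<in> diff_set (OMap \<Gamma> i) X"
      using leg_iff[OF x(1) X x(2)] z(1) x(3) by simp
    then have "x \<in> D.El i X" "z = cm (diff_arr U (l i)) X x"
      using leg[OF x(1) X] x(3) El[OF x(1) X] by simp_all
    then show ?thesis
      using x(1) by (intro bexI)
  qed
  moreover have "D.merge X i x j y"
    if X: "X \<in> U" and i: "i \<in> Obj I" and j: "j \<in> Obj I" and x: "x \<in> D.El i X" and y: "y \<in> D.El j X"
      and eq: "cm (diff_arr U (l i)) X x = cm (diff_arr U (l j)) X y" for X i j x y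
  proof -
    have x: "x \<in> diff_set (OMap \<Gamma> i) X" "x \<in> El i (plus1 X)"
      and y: "y \<in> diff_set (OMap \<Gamma> j) X" "y \<in> El j (plus1 X)"
      using x y El[OF i X] El[OF j X] by (auto simp: diff_set_iff)
    \<comment> \<open>The cospan found at X + 1 serves unchanged, because the transition maps of the
      difference diagram are restrictions of those of \<Gamma> at X + 1.\<close>
    have "merge (plus1 X) i x j y"
      using inj[OF plus1_in[OF X] i j x(2) y(2)] eq leg[OF i X x(1)] leg[OF j X y(1)] by simp
    then show ?thesis
      unfolding merge_def D.merge_def using tr[OF _ X x(1)] tr[OF _ X y(1)] by metis
  qed
  ultimately show ?thesis
    unfolding D.pointwise_colimit_def by blast
qed

text \<open>Among all functors, M and \<open>diff_obj U L\<close> are colimits of the same diagram,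
  hence isomorphic. M is taut by the results for confluent colimits applied to the difference
  diagram.\<close>

lemma Delta_colimit_isomorphic:
  assumes "is_colimit I (set_functor_cat U) \<Gamma> L l"
    and M: "is_colimit I (set_functor_cat U) \<Gamma>\<Delta> M m"
  shows "L \<in> Obj (taut_cat U)" "isomorphic (taut_cat U) M (OMap (Delta U) L)"
proof -
  interpret D: taut_diagram U I "\<Gamma>\<Delta>"
    by (rule taut_diagram_Delta)
  have L: "pointwise_colimit L l"
    by (rule is_colimit_pointwise[OF assms(1)])
  then have Lt: "taut_functor U L"
    by (rule pointwise_colimit_taut)
  then show "L \<in> Obj (taut_cat U)"
    by simp
  have taut: "taut_functor U M" "taut_functor U (diff_obj U L)"
    using D.pointwise_colimit_taut[OF D.is_colimit_pointwise[OF M]] taut_functor_diff_obj[OF Lt]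
    by blast+
  obtain f g where fg: "f \<in> Hom (set_functor_cat U) M (diff_obj U L)"
    "g \<in> Hom (set_functor_cat U) (diff_obj U L) M"
    "Comp (set_functor_cat U) g f = Id (set_functor_cat U) M"
    "Comp (set_functor_cat U) f g = Id (set_functor_cat U) (diff_obj U L)"
    using colimit_unique[OF category_set_functor_cat M
        D.pointwise_colimit_is_colimit[OF pointwise_colimit_Delta[OF L]]] by blast
  \<comment> \<open>Both directions have to be taut for the isomorphism to live in Taut, so the
    argument is repeated with f and g exchanged.\<close>
  have "taut_nat_trans U f" "taut_nat_trans U g"
    using taut_nat_trans_iso[OF fg taut(1)] taut_nat_trans_iso[OF fg(2,1,4,3) taut(2)] by blast+
  then have "f \<in> Hom (taut_cat U) M (diff_obj U L)" "g \<in> Hom (taut_cat U) (diff_obj U L) M"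
    using fg(1,2) taut by (simp_all add: hom_taut_cat hom_functor_cat)
  then have "isomorphic (taut_cat U) M (diff_obj U L)"
    using fg(3,4) taut unfolding isomorphic_def by auto
  then show "isomorphic (taut_cat U) M (OMap (Delta U) L)"
    using Lt by (simp add: Delta_def)
qed

end

theorem theorem3p2p6:
  fixes U :: "'u set set"
    and I :: "('i, 'b) cat"
    and \<Gamma> :: "('i, 'b, 'u set_functor, 'u set_nat_trans) func"
  assumes "set_universe U"
    and "category I"
    and "small_cat U I"
    and "confluent I"
    and "is_functor I (taut_cat U) \<Gamma>"
  shows "(\<exists>L l. is_colimit I (set_functor_cat U) \<Gamma> L l) \<and>
    (\<exists>M m. is_colimit I (set_functor_cat U) (comp_functor I (Delta U) \<Gamma>) M m) \<and>
    (\<forall>L l M m.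
      is_colimit I (set_functor_cat U) \<Gamma> L l \<longrightarrow>
      is_colimit I (set_functor_cat U) (comp_functor I (Delta U) \<Gamma>) M m \<longrightarrow>
      L \<in> Obj (taut_cat U) \<and>
      isomorphic (taut_cat U) M (OMap (Delta U) L))"
proof -
  interpret set_universe U + category I
    by fact+
  interpret taut_diagram U I \<Gamma>
    using assms(3-5) by unfold_locales (simp_all add: small_cat_def)
  \<comment> \<open>The second interpretation supplies existence of the colimit of the composite
    diagram.\<close>
  interpret D: taut_diagram U I "comp_functor I (Delta U) \<Gamma>"
    by (rule taut_diagram_Delta)
  show ?thesis
    using pointwise_colimit_exists pointwise_colimit_is_colimit D.pointwise_colimit_exists
      D.pointwise_colimit_is_colimit Delta_colimit_isomorphic by metis
qed

end
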